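(* Let $\mathbb{K}$ be a subfield of $\mathbb{C}$. Let $\eta\in\mathbb{C}$ be such that $0<|\eta|<1$ and $[\mathbb{K}(\eta):\mathbb{K}]<\infty$. Let $\{u_j\}_{j=1}^m\subset\mathbb{K}$ and let $p=(p_j)_{j=1}^m$ be a probability vector. Set $\nu=\sum_{j=1}^m p_j\delta_{u_j}$. Then $$h_{\eta,\nu}\ge\Phi_\nu\big(\widetilde{M}_{\mathbb{K}}(\eta)\big),\qquad\text{where}\qquad \widetilde{M}_{\mathbb{K}}(\eta)=\prod_{\eta_j}\frac{1}{\min\{1,|\eta_j|\}},$$ with the product running over all the conjugates $\eta_j$ of $\eta$ over $\mathbb{K}$ (including $\eta$ itself).
   Context: The Garsia entropy is $h_{\eta,\nu}=\lim_{n\to\infty}\frac1n H\big(\sum_{j=0}^{n-1}\xi_j\eta^j\big)$, where $(\xi_j)_{j\ge0}$ are independent random variables with common law $\nu$ and $H(X)=-\sum_x\mathbb{P}\{X=x\}\log\mathbb{P}\{X=x\}$ is here the Shannon entropy of a discrete random variable; the limit always exists by subadditivity. For a probability measure $\nu$ on $\mathbb{C}$ with bounded support and $a\in\mathbb{R}$, $$\Phi_\nu(a)=\sup_{t>0}\{H(ta\xi+G)-H(t\xi+G)\},$$ where $\xi$ is a complex random variable with law $\nu$, $G$ is a complex Gaussian random variable independent of $\xi$ with density $\exp(-|z|^2/2)/(2\pi)$ for $z\in\mathbb{C}$, and here $H(\cdot)$ is differential entropy: $H(X)=-\int f\log f$ for an absolutely continuous random variable $X$ in $\mathbb{C}\cong\mathbb{R}^2$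 with density $f$ with respect to Lebesgue measure. *)

theory Defs
  imports
    "HOL-Probability.Probability"
    "HOL-Algebra.Algebraic_Closure_Type"
    "HOL-Algebra.Generated_Fields"
begin

text \<open>All logarithms are natural; the information-theoretic constants of the library take the
  base as an argument, which is \<open>exp 1\<close> here.\<close>

subsection \<open>Field-theoretic notions\<close>

abbreviation complex_ring :: "complex ring" where
  "complex_ring \<equiv> ring_of_type_algebra"

definition adjoin :: "complex set \<Rightarrow> complex \<Rightarrow> complex set" where
  "adjoin K \<eta> = generate_field complex_ring (insert \<eta> K)"

text \<open>\<open>ring.Irr\<close> is the monic irreducible polynomial of an algebraic element, as a coefficient
  list.  Its roots are simple in characteristic 0, so a product over the set of conjugates is the
  same as a product over the roots with multiplicity.\<close>

definition conjugates :: "complex set \<Rightarrow> complex \<Rightarrow> complex set" where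
  "conjugates K \<eta> = {z. ring.eval complex_ring (ring.Irr complex_ring K \<eta>) z = 0}"

definition M_tilde :: "complex set \<Rightarrow> complex \<Rightarrow> real" where
  "M_tilde K \<eta> = (\<Prod>z\<in>conjugates K \<eta>. 1 / min 1 (cmod z))"


subsection \<open>Finitely supported laws on the complex plane\<close>

text \<open>The measure $\sum_{j=1}^m p_j\,\delta_{u_j}$; \<open>return borel a\<close> is the Dirac measure at \<open>a\<close>.
  The atoms \<open>u j\<close> need not be distinct.\<close>

definition atomic_law :: "nat \<Rightarrow> (nat \<Rightarrow> real) \<Rightarrow> (nat \<Rightarrow> complex) \<Rightarrow> complex measure" where
  "atomic_law m p u =
     measure_of UNIV (sets borel) (\<lambda>A. \<Sum>j=1..m. ennreal (p j) * emeasure (return borel (u j)) A)"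

lemma sets_atomic_law [simp, measurable_cong]: "sets (atomic_law m p u) = sets borel"
  unfolding atomic_law_def using sets.sigma_sets_eq[of "borel :: complex measure"] by simp

lemma space_atomic_law [simp]: "space (atomic_law m p u) = UNIV"
  unfolding atomic_law_def by (simp add: space_measure_of_conv)

lemma emeasure_atomic_law:
  assumes "A \<in> sets borel"
  shows "emeasure (atomic_law m p u) A = (\<Sum>j=1..m. ennreal (p j) * emeasure (return borel (u j)) A)"
proof (rule emeasure_measure_of[OF atomic_law_def])
  show "countably_additive (sets (atomic_law m p u))
          (\<lambda>A. \<Sum>j=1..m. ennreal (p j) * emeasure (return borel (u j)) A)"
  proof (rule countably_additiveI)
    fix F :: "nat \<Rightarrow> complex set"
    assume F: "range F \<subseteq> sets (atomic_law m p u)" "disjoint_family F"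
    have "(\<Sum>i. \<Sum>j=1..m. ennreal (p j) * emeasure (return borel (u j)) (F i)) =
          (\<Sum>j=1..m. \<Sum>i. ennreal (p j) * emeasure (return borel (u j)) (F i))"
      by (rule suminf_sum) simp
    also have "\<dots> = (\<Sum>j=1..m. ennreal (p j) * emeasure (return borel (u j)) (\<Union>i. F i))"
      using F by (intro sum.cong refl) (subst ennreal_suminf_cmult, subst suminf_emeasure, auto)
    finally show "(\<Sum>i. \<Sum>j=1..m. ennreal (p j) * emeasure (return borel (u j)) (F i)) =
      (\<Sum>j=1..m. ennreal (p j) * emeasure (return borel (u j)) (\<Union>i. F i))" .
  qed
qed (use assms in \<open>auto simp: positive_def\<close>)


subsection \<open>Garsia entropy\<close>

text \<open>Shannon entropy of a discrete complex random variable \<open>Z\<close> on \<open>M\<close>.  Points that \<open>Z\<close> does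
  not charge contribute \<open>0 * ln 0 = 0\<close>.\<close>

definition shannon_entropy :: "'a measure \<Rightarrow> ('a \<Rightarrow> complex) \<Rightarrow> real" where
  "shannon_entropy M Z =
     - (\<Sum>\<^sub>\<infinity>x. measure M {\<omega> \<in> space M. Z \<omega> = x} * ln (measure M {\<omega> \<in> space M. Z \<omega> = x}))"

text \<open>The coordinates of the product space \<open>\<Pi>\<^sub>M j\<in>UNIV. \<nu>\<close> are independent with common law \<open>\<nu>\<close>.
  The limit exists by subadditivity of entropy.\<close>

definition garsia_entropy :: "complex \<Rightarrow> complex measure \<Rightarrow> real" where
  "garsia_entropy \<eta> \<nu> =
     lim (\<lambda>n. shannon_entropy (\<Pi>\<^sub>M j\<in>(UNIV :: nat set). \<nu>) (\<lambda>\<xi>. \<Sum>j<n. \<xi> j * \<eta> ^ j) / real n)"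


subsection \<open>Gaussian smoothing\<close>

definition complex_gaussian :: "complex measure" where
  "complex_gaussian = density lborel (\<lambda>z. ennreal (exp (- (cmod z)\<^sup>2 / 2) / (2 * pi)))"

text \<open>Differential entropy of \<open>s \<xi> + G\<close>, with \<open>\<xi>\<close> and \<open>G\<close> the coordinates of the product space.
  The library's \<open>entropy\<close> relative to \<open>lborel\<close> is \<open>- (\<integral>z. f z * ln (f z) \<partial>lborel)\<close> for the density
  \<open>f\<close> of the random variable (lemma \<open>entropy_distr\<close>).\<close>

definition smoothed_entropy :: "complex measure \<Rightarrow> real \<Rightarrow> real" where
  "smoothed_entropy \<nu> s =
     prob_space.entropy (\<nu> \<Otimes>\<^sub>M complex_gaussian) (exp 1) lborel (\<lambda>(\<xi>, G). of_real s * \<xi> + G)"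

text \<open>The supremum is taken in the extended reals, so it needs no boundedness proof.\<close>

definition Phi :: "complex measure \<Rightarrow> real \<Rightarrow> ereal" where
  "Phi \<nu> a = (SUP t\<in>{0<..}. ereal (smoothed_entropy \<nu> (t * a) - smoothed_entropy \<nu> t))"

end

theory Submission
  imports Defs
begin

text \<open>
  Let \<open>\<eta>\<^sub>1, \<dots>, \<eta>\<^sub>r\<close> be the conjugates inside the unit disc.  For
  \<open>\<beta> k = \<Sum>\<^sub>i y\<^sub>i \<eta>\<^sub>i ^ (k + 1)\<close>, \<open>k \<in> \<int>\<close>, the sums
  \<open>f\<^sub>i = \<Sum>j<n. \<xi> j * \<beta> (j - i - 1)\<close>, \<open>i < n\<close>, are functions of
  \<open>Z = \<Sum>j<n. \<xi> j * \<eta> ^ j\<close>, because conjugation fixes the \<open>\<xi> j \<in> K\<close>.  Hence the Shannon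
  entropy of \<open>Z\<close> is at least the information about the \<open>\<xi> j\<close> contained in the noisy observations
  \<open>f\<^sub>i + G\<^sub>i\<close> with independent complex Gaussians \<open>G\<^sub>i\<close>.  By the chain rule this information is a sum of
  \<open>n\<close> gains.  The gain of \<open>f\<^sub>l + G\<^sub>l\<close> after the earlier observations decreases when all coordinates
  except \<open>\<xi> l\<close> are revealed; then \<open>\<xi> l\<close> is observed with the coefficients \<open>\<beta> (l - 1), \<dots>, \<beta> 0\<close>
  before and \<open>\<beta> (- 1)\<close> now.  By rotation invariance of the noise, observations with several
  coefficients are equivalent to a single one with their Euclidean norm.  So if
  \<open>\<Sum>k. |\<beta> k|\<^sup>2 \<le> t\<^sup>2\<close> over \<open>k \<ge> 0\<close> and \<open>|\<beta> (- 1)|\<^sup>2 = t\<^sup>2 * (a\<^sup>2 - 1)\<close>, each gain is at least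
  \<open>H (t * a * \<xi> + G) - H (t * \<xi> + G)\<close>.  For
  \<open>a = \<Prod>\<^sub>i 1 / |\<eta>\<^sub>i|\<close> one takes for \<open>\<beta> (- 1), \<beta> 0, \<dots>\<close> the Taylor coefficients of a multiple of
  \<open>1 - cnj (B 0) * B z\<close>, where \<open>B\<close> is the Blaschke product with zeros \<open>cnj \<eta>\<^sub>i\<close>.
\<close>

subsection \<open>Coefficients of Blaschke products\<close>

text \<open>As coefficient sequences of power series, \<open>f = (1 - a X) h\<close> and
  \<open>g = (X - cnj a) h\<close>, so \<open>g\<close> is \<open>f\<close> times the Blaschke
  factor \<open>(X - cnj a) / (1 - a X)\<close>, which has modulus 1 on the unit circle. For partial
  sums this isometry becomes a telescoping of \<open>|g k|^2 - |f k|^2\<close>, which leaves the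
  boundary term in \<open>h N\<close>.\<close>

lemma blaschke_step:
  fixes f h g :: "nat \<Rightarrow> complex" and a :: complex
  assumes f: "f 0 = h 0" "\<And>k. f (Suc k) = h (Suc k) - a * h k"
    and g: "g 0 = - cnj a * h 0" "\<And>k. g (Suc k) = h k - cnj a * h (Suc k)"
  shows "(\<Sum>k\<le>N. (cmod (g k))\<^sup>2) + (1 - (cmod a)\<^sup>2) * (cmod (h N))\<^sup>2 = (\<Sum>k\<le>N. (cmod (f k))\<^sup>2)"
proof (induction N)
  case 0
  then show ?case by (simp add: f g norm_mult power_mult_distrib algebra_simps)
next
  case (Suc N)
  have "(cmod (g (Suc N)))\<^sup>2 + (1 - (cmod a)\<^sup>2) * (cmod (h (Suc N)))\<^sup>2 =
    (cmod (f (Suc N)))\<^sup>2 + (1 - (cmod a)\<^sup>2) * (cmod (h N))\<^sup>2"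
    unfolding f g cmod_power2 by (simp add: power2_eq_square algebra_simps)
  with Suc show ?case by simp
qed

text \<open>\<open>g\<close> is the sequence of Taylor coefficients of the product of
  \<open>(X - cnj z) / (1 - z X)\<close> over \<open>I\<close>. Its partial fraction decomposition
  has the value at infinity \<open>\<Prod>z\<in>I. - 1 / z\<close> as constant term and
  \<open>x z\<close> as coefficient of \<open>1 / (1 - z X)\<close>. The induction multiplies by one
  Blaschke factor at a time.\<close>

lemma blaschke_coefficients:
  fixes I :: "complex set"
  assumes "finite I" "\<forall>z\<in>I. z \<noteq> 0 \<and> cmod z < 1"
  shows "\<exists>g x. g 0 = (\<Prod>z\<in>I. - cnj z) \<and> g 0 = (\<Prod>z\<in>I. - 1 / z) + (\<Sum>z\<in>I. x z) \<and>
    (\<forall>k. g (Suc k) = (\<Sum>z\<in>I. x z * z ^ Suc k)) \<and> (\<forall>N. (\<Sum>k\<le>N. (cmod (g k))\<^sup>2) \<le> 1)"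
  using assms
proof (induction I)
  case empty
  have "(\<Sum>k\<le>N. (cmod (if k = 0 then 1 else 0))\<^sup>2) \<le> 1" for N :: nat
    by (simp add: if_distrib[of cmod] if_distrib[of "\<lambda>x. x\<^sup>2"] cong: if_cong)
  then show ?case by (intro exI[of _ "\<lambda>k. if k = 0 then 1 else 0"]) auto
next
  case (insert a I)
  then obtain f x where f: "f 0 = (\<Prod>z\<in>I. - cnj z)" "f 0 = (\<Prod>z\<in>I. - 1 / z) + (\<Sum>z\<in>I. x z)"
    "\<And>k. f (Suc k) = (\<Sum>z\<in>I. x z * z ^ Suc k)" "\<And>N. (\<Sum>k\<le>N. (cmod (f k))\<^sup>2) \<le> 1"
    by auto
  have a: "a \<noteq> 0" "cmod a < 1" using insert by auto
  have ne: "z - a \<noteq> 0" if "z \<in> I" for z using insert that by auto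
  \<comment> \<open>Here \<open>h\<close> is \<open>f / (1 - a X)\<close>: each product
    \<open>1 / ((1 - z X) (1 - a X))\<close> is split as
    \<open>(z / (1 - z X) - a / (1 - a X)) / (z - a)\<close>, whence the divisor in
    \<open>w\<close>, and \<open>c\<close> is the value of \<open>f\<close> at infinity.\<close>
  define c where "c = (\<Prod>z\<in>I. - 1 / z)"
  define w where "w z = x z / (z - a)" for z
  have w: "x z = w z * (z - a)" if "z \<in> I" for z using ne[OF that] by (simp add: w_def)
  define h where "h k = c * a ^ k + (\<Sum>z\<in>I. w z * (z ^ Suc k - a ^ Suc k))" for k
  define g where "g k = (case k of 0 \<Rightarrow> - cnj a * h 0 | Suc k \<Rightarrow> h k - cnj a * h (Suc k))" for k
  have h0: "h 0 = f 0" unfolding h_def f(2) c_def using w by (simp cong: sum.cong)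
  have hS: "f (Suc k) = h (Suc k) - a * h k" for k
  proof -
    have "h (Suc k) - a * h k = (\<Sum>z\<in>I. w z * (z ^ Suc (Suc k) - a ^ Suc (Suc k)) -
      a * (w z * (z ^ Suc k - a ^ Suc k)))"
      unfolding h_def by (simp add: sum_distrib_left sum_subtractf distrib_left)
    also have "\<dots> = f (Suc k)" unfolding f(3)
    proof (intro sum.cong refl)
      fix z assume "z \<in> I"
      then show "w z * (z ^ Suc (Suc k) - a ^ Suc (Suc k)) - a * (w z * (z ^ Suc k - a ^ Suc k))
        = x z * z ^ Suc k" by (simp add: w algebra_simps)
    qed
    finally show ?thesis by simp
  qed
  have bound: "(\<Sum>k\<le>N. (cmod (g k))\<^sup>2) \<le> 1" for N
  proof -
    have "(cmod a)\<^sup>2 \<le> 1" using a by (simp add: power_le_one)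
    then have "0 \<le> (1 - (cmod a)\<^sup>2) * (cmod (h N))\<^sup>2" by simp
    moreover have "(\<Sum>k\<le>N. (cmod (g k))\<^sup>2) + (1 - (cmod a)\<^sup>2) * (cmod (h N))\<^sup>2 = (\<Sum>k\<le>N. (cmod (f k))\<^sup>2)"
      by (rule blaschke_step) (auto simp: h0 hS g_def)
    ultimately show ?thesis using f(4)[of N] by linarith
  qed
  \<comment> \<open>The coefficient at the new pole: \<open>y * a ^ Suc k\<close> collects all
    powers of \<open>a\<close> in \<open>h k - cnj a * h (Suc k)\<close>.\<close>
  define y where "y = c / a - c * cnj a - (\<Sum>z\<in>I. w z * (1 - cnj a * a))"
  define x' where "x' z = (if z = a then y else w z * (1 - cnj a * z))" for z
  have x'I: "(\<Sum>z\<in>I. F (x' z) z) = (\<Sum>z\<in>I. F (w z * (1 - cnj a * z)) z)" for F :: "complex \<Rightarrow> complex \<Rightarrow> complex"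
    using insert by (intro sum.cong) (auto simp: x'_def)
  have "g (Suc k) = (\<Sum>z\<in>insert a I. x' z * z ^ Suc k)" for k
  proof -
    have "(\<Sum>z\<in>insert a I. x' z * z ^ Suc k) = y * a ^ Suc k + (\<Sum>z\<in>I. w z * (1 - cnj a * z) * z ^ Suc k)"
      using insert x'I[of "\<lambda>x z. x * z ^ Suc k"] by (simp add: x'_def)
    also have "\<dots> = c * a ^ k - cnj a * (c * a ^ Suc k) +
       (\<Sum>z\<in>I. w z * (1 - cnj a * z) * z ^ Suc k - w z * (1 - cnj a * a) * a ^ Suc k)"
    proof -
      have "y * a ^ Suc k = c * a ^ k - cnj a * (c * a ^ Suc k) - (\<Sum>z\<in>I. w z * (1 - cnj a * a) * a ^ Suc k)"
        unfolding y_def left_diff_distrib sum_distrib_right using a by simp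
      then show ?thesis unfolding sum_subtractf by simp
    qed
    also have "(\<Sum>z\<in>I. w z * (1 - cnj a * z) * z ^ Suc k - w z * (1 - cnj a * a) * a ^ Suc k) =
      (\<Sum>z\<in>I. w z * (z ^ Suc k - a ^ Suc k) - cnj a * (w z * (z ^ Suc (Suc k) - a ^ Suc (Suc k))))"
      by (intro sum.cong refl) (simp add: algebra_simps)
    also have "c * a ^ k - cnj a * (c * a ^ Suc k) + \<dots> = g (Suc k)"
      unfolding g_def h_def sum_subtractf nat.case distrib_left sum_distrib_left[symmetric]
      by (simp only: diff_diff_eq2 add_diff_eq diff_add_eq diff_diff_eq add_ac)
    finally show ?thesis by simp
  qed
  moreover have "g 0 = (\<Prod>z\<in>insert a I. - cnj z)" using insert by (simp add: g_def h0 f(1))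
  moreover have "g 0 = (\<Prod>z\<in>insert a I. - 1 / z) + (\<Sum>z\<in>insert a I. x' z)"
  proof -
    have "(\<Sum>z\<in>insert a I. x' z) = y + (\<Sum>z\<in>I. w z * (1 - cnj a * z))"
      using insert x'I[of "\<lambda>x z. x"] by (simp add: x'_def)
    also have "\<dots> = c / a - c * cnj a + (\<Sum>z\<in>I. w z * (1 - cnj a * z) - w z * (1 - cnj a * a))"
      unfolding y_def sum_subtractf by simp
    also have "(\<Sum>z\<in>I. w z * (1 - cnj a * z) - w z * (1 - cnj a * a)) = (\<Sum>z\<in>I. - cnj a * x z)"
    proof (intro sum.cong refl)
      fix z assume "z \<in> I"
      then show "w z * (1 - cnj a * z) - w z * (1 - cnj a * a) = - cnj a * x z"
        by (simp add: w algebra_simps)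
    qed
    finally have 1: "(\<Sum>z\<in>insert a I. x' z) = c / a - c * cnj a + (\<Sum>z\<in>I. - cnj a * x z)" .
    have 2: "(\<Prod>z\<in>insert a I. - 1 / z) = - c / a"
      using insert by (simp add: c_def)
    have "g 0 = - cnj a * (c + sum x I)" by (simp add: g_def h0 f(2) c_def)
    then show ?thesis unfolding 1 2 by (simp add: sum_negf sum_distrib_left[symmetric] algebra_simps)
  qed
  ultimately show ?case using bound by blast
qed

text \<open>The sums \<open>\<Sum>z\<in>I. y z * z ^ k\<close> are the Taylor coefficients of
  \<open>l * (1 - cnj (B 0) * B)\<close>. The value of \<open>B\<close> at infinity is the inverse
  of \<open>cnj (B 0)\<close>, so the constant 1 cancels it and the coefficients are pure
  exponential sums from index 0 on.\<close>

lemma extremal_recurrence: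
  fixes I :: "complex set" and t :: real
  assumes I: "finite I" "\<forall>z\<in>I. z \<noteq> 0 \<and> cmod z < 1" and "I \<noteq> {}" "0 < t"
  defines "a \<equiv> \<Prod>z\<in>I. 1 / cmod z"
  shows "\<exists>y. (cmod (\<Sum>z\<in>I. y z))\<^sup>2 = t\<^sup>2 * (a\<^sup>2 - 1) \<and>
    (\<forall>N. (\<Sum>k<N. (cmod (\<Sum>z\<in>I. y z * z ^ Suc k))\<^sup>2) \<le> t\<^sup>2)"
proof -
  obtain g x where g: "g 0 = (\<Prod>z\<in>I. - cnj z)" "g 0 = (\<Prod>z\<in>I. - 1 / z) + (\<Sum>z\<in>I. x z)"
    "\<And>k. g (Suc k) = (\<Sum>z\<in>I. x z * z ^ Suc k)" "\<And>N. (\<Sum>k\<le>N. (cmod (g k))\<^sup>2) \<le> 1"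
    using blaschke_coefficients[OF I] by (elim exE conjE) blast
  define r where "r = (\<Prod>z\<in>I. cmod z)"
  have r: "0 < r" using I by (auto simp: r_def intro!: prod_pos)
  have "r < 1"
  proof -
    \<comment> \<open>Nonemptiness of \<open>I\<close> gives \<open>r < 1\<close>, so that the
      divisor in \<open>l\<close> below is nonzero.\<close>
    obtain z where "z \<in> I" using \<open>I \<noteq> {}\<close> by auto
    then have "r = cmod z * (\<Prod>z\<in>I - {z}. cmod z)" unfolding r_def using I(1) by (rule prod.remove[rotated])
    moreover have "(\<Prod>z\<in>I - {z}. cmod z) \<le> 1" using I by (intro prod_le_1) (auto intro: less_imp_le)
    ultimately have "r \<le> cmod z" using mult_left_mono[of _ 1 "cmod z"] by simp
    then show ?thesis using I \<open>z \<in> I\<close> by force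
  qed
  then have r1: "0 < 1 - r\<^sup>2" using r by (simp add: power_less_one_iff abs_square_less_1)
  have ar: "a = 1 / r" by (simp add: a_def r_def prod_dividef)
  have g0: "cmod (g 0) = r" by (simp add: g(1) r_def flip: prod_norm)
  \<comment> \<open>The squares of \<open>g\<close> from index 1 on sum to at most
    \<open>1 - r\<^sup>2\<close>, and the sequence is \<open>g\<close> scaled by a factor of modulus
    \<open>l * r\<close>; this \<open>l\<close> turns the bound into exactly
    \<open>t\<^sup>2\<close>.\<close>
  define l where "l = t / (r * sqrt (1 - r\<^sup>2))"
  have l2: "l\<^sup>2 * (r\<^sup>2 * (1 - r\<^sup>2)) = t\<^sup>2" using r r1 by (simp add: l_def power_divide power_mult_distrib)
  define y where "y z = - l * cnj (g 0) * x z" for z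
  have "cnj (g 0) * (\<Prod>z\<in>I. - 1 / z) = 1"
    using I by (simp add: g(1) prod.distrib[symmetric] flip: prod.distrib cong: prod.cong)
  moreover have "cnj (g 0) * g 0 = of_real (r\<^sup>2)" by (metis complex_norm_square g0 mult.commute)
  ultimately have A: "cnj (g 0) * (\<Sum>z\<in>I. x z) = of_real (r\<^sup>2) - 1"
    by (metis add_diff_cancel_left' distrib_left g(2))
  have B: "(\<Sum>z\<in>I. y z) = - of_real l * (cnj (g 0) * (\<Sum>z\<in>I. x z))"
    unfolding y_def sum_distrib_left by (simp add: mult.assoc)
  have "(\<Sum>z\<in>I. y z) = of_real (l * (1 - r\<^sup>2))"
    unfolding B A by (simp add: algebra_simps)
  then have "(cmod (\<Sum>z\<in>I. y z))\<^sup>2 = l\<^sup>2 * (1 - r\<^sup>2)\<^sup>2" by (simp only: norm_of_real power2_abs power_mult_distrib)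
  also have "\<dots> = t\<^sup>2 * (a\<^sup>2 - 1)"
    unfolding l2[symmetric] ar using r by (simp add: field_simps power2_eq_square)
  finally have 1: "(cmod (\<Sum>z\<in>I. y z))\<^sup>2 = t\<^sup>2 * (a\<^sup>2 - 1)" .
  have "(\<Sum>k<N. (cmod (\<Sum>z\<in>I. y z * z ^ Suc k))\<^sup>2) \<le> t\<^sup>2" for N
  proof -
    have "(\<Sum>z\<in>I. y z * z ^ Suc k) = - l * cnj (g 0) * g (Suc k)" for k
      by (simp add: y_def g(3) sum_negf sum_distrib_left mult_ac)
    then have "(\<Sum>k<N. (cmod (\<Sum>z\<in>I. y z * z ^ Suc k))\<^sup>2) = l\<^sup>2 * r\<^sup>2 * (\<Sum>k<N. (cmod (g (Suc k)))\<^sup>2)"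
      by (simp add: norm_mult g0 power_mult_distrib sum_distrib_left)
    moreover have "(\<Sum>k<N. (cmod (g (Suc k)))\<^sup>2) \<le> 1 - r\<^sup>2"
      using g(4)[of N] unfolding sum.atMost_shift by (simp add: g0)
    ultimately have "(\<Sum>k<N. (cmod (\<Sum>z\<in>I. y z * z ^ Suc k))\<^sup>2) \<le> l\<^sup>2 * r\<^sup>2 * (1 - r\<^sup>2)"
      by (simp add: mult_left_mono)
    then show ?thesis using l2 by (simp add: mult.assoc)
  qed
  with 1 show ?thesis by blast
qed

subsection \<open>Subadditive sequences\<close>

text \<open>Fekete's lemma: the limit is the infimum \<open>L\<close>. Division of \<open>n\<close>
  by a nearly optimal \<open>k\<close> leaves a remainder below \<open>k\<close>, whose contribution
  is at most the constant \<open>C\<close>.\<close>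

lemma subadditive_convergent:
  fixes a :: "nat \<Rightarrow> real"
  assumes nonneg: "\<And>n. 0 \<le> a n" and sub: "\<And>m n. a (m + n) \<le> a m + a n"
  shows "convergent (\<lambda>n. a n / n)"
proof -
  define L where "L = (INF n\<in>{1..}. a n / real n)"
  have bdd: "bdd_below ((\<lambda>n. a n / real n) ` {1..})"
    using nonneg by (intro bdd_belowI[of _ 0]) auto
  have mult: "a (q * k + r) \<le> q * a k + a r" for q k r
  proof (induction q)
    case (Suc q)
    then show ?case using sub[of k "q * k + r"] by (simp add: algebra_simps)
  qed simp
  have "(\<lambda>n. a n / n) \<longlonglongrightarrow> L"
  proof (rule order_tendstoI)
    fix x assume "x < L"
    have "L \<le> a n / n" if "1 \<le> n" for n
      unfolding L_def using that by (intro cINF_lower[OF bdd]) auto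
    with \<open>x < L\<close> show "\<forall>\<^sub>F n in sequentially. x < a n / n"
      by (intro eventually_sequentiallyI[of 1]) (auto intro: less_le_trans)
  next
    fix x assume "L < x"
    then obtain k where k: "1 \<le> k" "a k / k < x"
      unfolding L_def using bdd by (subst (asm) cINF_less_iff) auto
    define C where "C = (\<Sum>r<k. a r)"
    have "(\<lambda>n. a k / k + C / real n) \<longlonglongrightarrow> a k / k + 0"
      by (intro tendsto_intros lim_const_over_n)
    then have ev: "\<forall>\<^sub>F n in sequentially. a k / k + C / real n < x"
      using k by (intro order_tendstoD) auto
    have le: "a n / n \<le> a k / k + C / real n" if "1 \<le> n" for n
    proof -
      have "a (n mod k) \<le> C"
        unfolding C_def using k nonneg by (intro member_le_sum) auto
      then have "a n \<le> real (n div k) * a k + C"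
        using mult[of "n div k" k "n mod k"] by simp
      also have "real (n div k) * a k \<le> n / k * a k"
      proof (rule mult_right_mono[OF _ nonneg])
        have "real (n div k * k) \<le> real n" by (simp only: of_nat_le_iff div_times_less_eq_dividend)
        then show "real (n div k) \<le> n / k" using k by (simp add: field_simps)
      qed
      finally have "a n / n \<le> (n / k * a k + C) / n" by (intro divide_right_mono) auto
      also have "\<dots> = a k / k + C / n" using that by (simp add: add_divide_distrib)
      finally show ?thesis .
    qed
    show "\<forall>\<^sub>F n in sequentially. a n / n < x"
      using ev eventually_ge_at_top[of 1]
    proof eventually_elim
      case (elim n)
      then show ?case using le[of n] by linarith
    qed
  qed
  then show ?thesis by (rule convergentI)
qed

subsection \<open>Conjugates\<close>

interpretation cx: domain complex_ring
  using field_from_type_algebra by (rule field.axioms)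

lemma complex_ring_simps [simp]:
  "carrier complex_ring = UNIV" "\<zero>\<^bsub>complex_ring\<^esub> = 0" "\<one>\<^bsub>complex_ring\<^esub> = 1"
  "x \<oplus>\<^bsub>complex_ring\<^esub> y = x + y" "x \<otimes>\<^bsub>complex_ring\<^esub> y = x * y"
  by (auto simp: ring_of_type_algebra_def)

lemma complex_ring_pow [simp]: "x [^]\<^bsub>complex_ring\<^esub> (n::nat) = x ^ n"
  by (induction n) auto

lemma eval_map_rev: "cx.eval (map c (rev [0..<n])) z = (\<Sum>j<n. c j * z ^ j)"
  by (induction n) auto

context
  fixes K :: "complex set" and \<eta> :: complex
  assumes K: "subfield K complex_ring"
    and alg: "cx.finite_dimension K (adjoin K \<eta>)"
begin

lemma algebraic_over: "(cx.algebraic over K) \<eta>"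
proof (rule cx.finite_dimension_imp_algebraic[OF K _ alg])
  show "subring (adjoin K \<eta>) complex_ring"
    unfolding adjoin_def
    by (rule subfieldE(1), rule field.generate_field_is_subfield) (auto intro: field_from_type_algebra)
  show "\<eta> \<in> adjoin K \<eta>"
    unfolding adjoin_def by (auto intro: generate_field.incl)
qed

lemma mem_conjugates: "\<eta> \<in> conjugates K \<eta>"
  using cx.IrrE(4)[OF K _ algebraic_over] by (simp add: conjugates_def)

lemma Irr_poly:
  "cx.Irr K \<eta> \<in> carrier (K [X]\<^bsub>complex_ring\<^esub>)" "cx.Irr K \<eta> \<noteq> []" "set (cx.Irr K \<eta>) \<subseteq> K"
proof -
  show *: "cx.Irr K \<eta> \<in> carrier (K [X]\<^bsub>complex_ring\<^esub>)"
    using cx.IrrE(1)[OF K _ algebraic_over] by simp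
  show "cx.Irr K \<eta> \<noteq> []"
    using cx.pirreducibleE(1)[OF subfieldE(1)[OF K] *] cx.IrrE(2)[OF K _ algebraic_over] by simp
  show "set (cx.Irr K \<eta>) \<subseteq> K"
    using * by (meson cx.polynomial_incl univ_poly_carrier)
qed

text \<open>A polynomial over \<open>K\<close> that vanishes at \<open>\<eta>\<close> is a multiple
  of the minimal polynomial, hence vanishes at all roots of the latter. Applied to differences of
  two configurations, it shows that the value at \<open>\<eta>\<close> determines the value at every
  conjugate.\<close>

lemma conjugates_root:
  assumes z: "z \<in> conjugates K \<eta>" and c: "\<And>j. j < n \<Longrightarrow> c j \<in> K" and "(\<Sum>j<n. c j * \<eta> ^ j) = 0"
  shows "(\<Sum>j<n. c j * z ^ j) = 0"
proof -
  \<comment> \<open>Coefficient lists start with the leading coefficient, hence \<open>rev\<close>;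
    \<open>normalize\<close> strips leading zeros, which polynomials over \<open>K\<close> must not
    have.\<close>
  define q where "q = cx.normalize (map c (rev [0..<n]))"
  have ev: "cx.eval q x = (\<Sum>j<n. c j * x ^ j)" for x
    unfolding q_def by (subst cx.eval_normalize) (auto simp: eval_map_rev)
  have "set (map c (rev [0..<n])) \<subseteq> K" using c by auto
  then have q: "q \<in> carrier (K [X]\<^bsub>complex_ring\<^esub>)"
    unfolding q_def using cx.normalize_gives_polynomial univ_poly_carrier by blast
  have "cx.Irr K \<eta> pdivides\<^bsub>complex_ring\<^esub> q"
    by (rule cx.Irr_minimal[OF K _ algebraic_over q]) (auto simp: ev assms)
  then obtain r where r: "r \<in> carrier (poly_ring complex_ring)" 
      "q = cx.Irr K \<eta> \<otimes>\<^bsub>poly_ring complex_ring\<^esub> r"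
    unfolding pdivides_def factor_def by auto
  have "cx.Irr K \<eta> \<in> carrier (poly_ring complex_ring)"
    using Irr_poly(1) by (metis UNIV_I complex_ring_simps(1) cx.carrier_polynomial_shell K subfieldE(1))
  moreover have zc: "z \<in> carrier complex_ring" by simp
  ultimately have "cx.eval q z = cx.eval (cx.Irr K \<eta>) z * cx.eval r z"
    using r ring_hom_mult[OF ring_hom_ring.homh[OF cx.eval_ring_hom[OF cx.carrier_is_subring zc]]] by simp
  with z show ?thesis by (simp add: ev conjugates_def)
qed

text \<open>If 0 were a root, the minimal polynomial would have constant coefficient 0, and dividing
  it by \<open>X\<close> would give a polynomial of smaller degree that still vanishes at
  \<open>\<eta>\<close>.\<close>

lemma zero_notin_conjugates:
  assumes "\<eta> \<noteq> 0" shows "0 \<notin> conjugates K \<eta>"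
proof
  assume "0 \<in> conjugates K \<eta>"
  then have 0: "cx.eval (cx.Irr K \<eta>) 0 = 0" by (simp add: conjugates_def)
  obtain q k where q: "cx.Irr K \<eta> = q @ [k]" using Irr_poly(2) by (metis rev_exhaust)
  have ev: "cx.eval (q @ [k]) x = cx.eval q x * x + k" for x
    by (subst cx.eval_append_aux) auto
  have k: "k = 0" using 0 unfolding q ev by simp
  have "cx.eval q \<eta> * \<eta> + k = 0" using mem_conjugates unfolding conjugates_def q ev[symmetric] by simp
  with k assms have q0: "cx.eval q \<eta> = 0" by simp
  have "lead_coeff (cx.Irr K \<eta>) = 1" using cx.IrrE(3)[OF K _ algebraic_over] by simp
  then have ne: "q \<noteq> []" using k q by auto
  have "q \<in> carrier (K [X]\<^bsub>complex_ring\<^esub>)"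
    using Irr_poly(1) ne unfolding q univ_poly_carrier[symmetric] polynomial_def by auto
  then have "cx.Irr K \<eta> pdivides\<^bsub>complex_ring\<^esub> q"
    by (intro cx.Irr_minimal[OF K _ algebraic_over]) (auto simp: q0)
  then have "length (cx.Irr K \<eta>) - 1 \<le> length q - 1"
    using cx.pdivides_imp_degree_le[OF subfieldE(1)[OF K] Irr_poly(1) \<open>q \<in> _\<close> ne] by simp
  then show False using ne by (cases q) (auto simp: q)
qed

lemma finite_conjugates: "finite (conjugates K \<eta>)"
proof -
  have "cx.Irr K \<eta> \<in> carrier (poly_ring complex_ring)"
    using Irr_poly(1) by (metis UNIV_I complex_ring_simps(1) cx.carrier_polynomial_shell K subfieldE(1))
  then have "finite {z. cx.is_root (cx.Irr K \<eta>) z}"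
    using cx.finite_number_of_roots by (metis)
  then show ?thesis using Irr_poly(2) by (simp add: conjugates_def cx.is_root_def)
qed

end

subsection \<open>Gaussian observations of a finitely valued variable\<close>

definition gauss :: "complex \<Rightarrow> real" where
  "gauss z = exp (- (cmod z)\<^sup>2 / 2) / (2 * pi)"

lemma gauss_pos [simp]: "0 < gauss z"
  by (simp add: gauss_def)

lemma gauss_nonneg [simp]: "0 \<le> gauss z"
  by (simp add: less_imp_le)

lemma gauss_neq_0 [simp]: "gauss z \<noteq> 0"
  by (simp add: less_imp_neq[symmetric])

lemma borel_measurable_gauss [measurable]: "gauss \<in> borel_measurable borel"
  unfolding gauss_def by measurable

lemma nn_integral_gauss: "(\<integral>\<^sup>+z. ennreal (gauss z) \<partial>lborel) = 1"
proof -
  have 1: "(\<integral>\<^sup>+x. ennreal (std_normal_density x) \<partial>lborel) = 1"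
    using prob_space.emeasure_space_1[OF prob_space_normal_density[of 1 0]]
    by (simp add: emeasure_density)
  have "gauss z = std_normal_density (Re z) * std_normal_density (Im z)" for z
    by (simp add: gauss_def std_normal_density_def cmod_power2 exp_add[symmetric] add_divide_distrib)
  then have "ennreal (gauss z) = (\<Prod>b\<in>Basis. ennreal (std_normal_density (z \<bullet> b)))" for z
    by (simp add: Basis_complex_def ennreal_mult complex_eq_iff)
  then show ?thesis
    by (simp add: nn_integral_lborel_prod[where f = "\<lambda>_ x. ennreal (std_normal_density x)"] 1)
qed

lemma nn_integral_lborel_shift:
  fixes f :: "complex \<Rightarrow> ennreal"
  assumes [measurable]: "f \<in> borel_measurable borel"
  shows "(\<integral>\<^sup>+z. f (z + c) \<partial>lborel) = (\<integral>\<^sup>+z. f z \<partial>lborel)"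
proof -
  have "(\<integral>\<^sup>+z. f z \<partial>lborel) = (\<integral>\<^sup>+z. f z \<partial>distr lborel borel ((+) c))"
    by (simp add: lborel_distr_plus)
  also have "\<dots> = (\<integral>\<^sup>+z. f (z + c) \<partial>lborel)"
    by (subst nn_integral_distr) (auto simp: add.commute)
  finally show ?thesis by simp
qed

lemma has_bochner_integral_gauss: "has_bochner_integral lborel (\<lambda>z. gauss (z - c)) 1"
proof (rule has_bochner_integral_nn_integral)
  show "(\<integral>\<^sup>+z. ennreal (gauss (z - c)) \<partial>lborel) = ennreal 1"
    using nn_integral_lborel_shift[of "\<lambda>z. ennreal (gauss z)" "- c"] by (simp add: nn_integral_gauss)
qed auto

lemma has_bochner_integral_gauss_sum:
  fixes c :: "'w \<Rightarrow> real"
  shows "has_bochner_integral lborel (\<lambda>z. \<Sum>w\<in>W. c w * gauss (z - f w)) (\<Sum>w\<in>W. c w)"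
proof (rule has_bochner_integral_sum)
  show "has_bochner_integral lborel (\<lambda>z. c w * gauss (z - f w)) (c w)" for w
    using has_bochner_integral_mult_right[of "c w" lborel "\<lambda>z. gauss (z - f w)" 1]
      has_bochner_integral_gauss by simp
qed

lemma nn_integral_gauss_sum:
  assumes "\<And>z. 0 \<le> (\<Sum>w\<in>W. c w * gauss (z - f w))"
  shows "(\<integral>\<^sup>+z. ennreal (\<Sum>w\<in>W. c w * gauss (z - f w)) \<partial>lborel) = ennreal (\<Sum>w\<in>W. c w)"
  using has_bochner_integral_gauss_sum[of c f W] assms
  by (subst nn_integral_eq_integral) (auto simp: has_bochner_integral_iff)

section \<open>Weights, posteriors and homogeneous functionals\<close>

text \<open>A vector of weights \<open>q\<close> on a finite set \<open>W\<close> is an unnormalised law of a random \<open>w\<close>; observing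
  the value \<open>y\<close> of \<open>f w\<close> plus Gaussian noise replaces it by the unnormalised posterior
  \<open>observe W f q y\<close>, whose total mass \<open>mixture W f q y\<close> is the density of the observation.  No
  normalisation is needed for homogeneous functionals.  The value of \<open>gain\<close> is the total mass times
  the mutual information of \<open>w\<close> and the observation, and \<open>uncertainty\<close> is the total mass times the
  Shannon entropy of \<open>Z w\<close>.\<close>

definition observe :: "'w set \<Rightarrow> ('w \<Rightarrow> complex) \<Rightarrow> ('w \<Rightarrow> real) \<Rightarrow> complex \<Rightarrow> 'w \<Rightarrow> real" where
  "observe W f q y = (\<lambda>w\<in>W. q w * gauss (y - f w))"

text \<open>For a probability vector \<open>q\<close> and homogeneous \<open>F\<close> this is the
  expected value of \<open>F\<close> at the normalised posterior: the density of the observation is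
  already contained in the mass of \<open>observe W f q y\<close>.\<close>

definition averaged ::
    "'w set \<Rightarrow> ('w \<Rightarrow> complex) \<Rightarrow> (('w \<Rightarrow> real) \<Rightarrow> ennreal) \<Rightarrow> ('w \<Rightarrow> real) \<Rightarrow> ennreal" where
  "averaged W f F q = (\<integral>\<^sup>+y. F (observe W f q y) \<partial>lborel)"

definition mixture :: "'w set \<Rightarrow> ('w \<Rightarrow> complex) \<Rightarrow> ('w \<Rightarrow> real) \<Rightarrow> complex \<Rightarrow> real" where
  "mixture W f q y = (\<Sum>w\<in>W. q w * gauss (y - f w))"

definition gain_density :: "'w set \<Rightarrow> ('w \<Rightarrow> complex) \<Rightarrow> ('w \<Rightarrow> real) \<Rightarrow> complex \<Rightarrow> real" where
  "gain_density W f q y =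
     (\<Sum>w\<in>W. q w * (gauss (y - f w) * ln (gauss (y - f w) * sum q W / mixture W f q y)))"

definition gain :: "'w set \<Rightarrow> ('w \<Rightarrow> complex) \<Rightarrow> ('w \<Rightarrow> real) \<Rightarrow> ennreal" where
  "gain W f q = (\<integral>\<^sup>+y. ennreal (gain_density W f q y) \<partial>lborel)"

definition uncertainty :: "'w set \<Rightarrow> ('w \<Rightarrow> 'z) \<Rightarrow> ('w \<Rightarrow> real) \<Rightarrow> real" where
  "uncertainty W Z q = (\<Sum>w\<in>W. q w * ln (sum q W / sum q {v\<in>W. Z v = Z w}))"

text \<open>Measurability allows averaging to be iterated. The second clause makes \<open>F\<close>
  blind to values outside \<open>W\<close>, where posteriors are \<open>undefined\<close>.
  Homogeneity absorbs the masses of unnormalised posteriors.\<close>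

definition functional :: "'w set \<Rightarrow> (('w \<Rightarrow> real) \<Rightarrow> ennreal) \<Rightarrow> bool" where
  "functional W F \<longleftrightarrow> F \<in> borel_measurable (PiM W (\<lambda>_. borel)) \<and>
     (\<forall>q. F (restrict q W) = F q) \<and>
     (\<forall>c q. 0 < c \<longrightarrow> (\<forall>w\<in>W. 0 \<le> q w) \<longrightarrow> F (\<lambda>w. c * q w) = ennreal c * F q)"

definition weight :: "'w set \<Rightarrow> ('w \<Rightarrow> real) \<Rightarrow> bool" where
  "weight W q \<longleftrightarrow> (\<forall>w\<in>W. 0 \<le> q w)"

lemma weightD: "weight W q \<Longrightarrow> w \<in> W \<Longrightarrow> 0 \<le> q w"
  by (simp add: weight_def)

lemma weight_observe: "weight W q \<Longrightarrow> weight W (observe W f q y)"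
  by (simp add: weight_def observe_def)

lemma functionalD:
  assumes "functional W F"
  shows "F \<in> borel_measurable (PiM W (\<lambda>_. borel))" "F (restrict q W) = F q"
    "0 < c \<Longrightarrow> weight W q \<Longrightarrow> F (\<lambda>w. c * q w) = ennreal c * F q"
  using assms by (auto simp: functional_def weight_def)

lemma functional_cong:
  assumes "functional W F" "\<And>w. w \<in> W \<Longrightarrow> q w = q' w"
  shows "F q = F q'"
  using functionalD(2)[OF assms(1), of q] functionalD(2)[OF assms(1), of q'] assms(2)
  by (metis restrict_ext)

lemma mixture_eq_sum_observe: "mixture W f q y = sum (observe W f q y) W"
  by (simp add: mixture_def observe_def)

lemma mixture_pos:
  assumes "finite W" "weight W q" "0 < sum q W"
  shows "0 < mixture W f q y"
proof -
  obtain w where "w \<in> W" "0 < q w"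
    using assms(3) by (metis sum_nonpos not_less)
  then show ?thesis unfolding mixture_def
    using assms by (intro sum_pos2[of _ w]) (auto simp: weight_def)
qed

lemma sum_weight_cases:
  assumes "finite W" "weight W q"
  obtains "\<And>w. w \<in> W \<Longrightarrow> q w = 0" | "0 < sum q W"
proof (cases "sum q W = 0")
  case True
  then show ?thesis using assms that(1) by (auto simp: sum_nonneg_eq_0_iff weight_def)
next
  case False
  then show ?thesis using assms that(2) sum_nonneg[of W q] by (auto simp: weight_def)
qed

lemma measurable_observe_pair [measurable]:
  "(\<lambda>(q, y). observe W f q y) \<in> PiM W (\<lambda>_. borel) \<Otimes>\<^sub>M borel \<rightarrow>\<^sub>M PiM W (\<lambda>_. borel)"
  unfolding observe_def case_prod_beta by (intro measurable_restrict) measurable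

lemma measurable_observe [measurable]: "observe W f q \<in> borel \<rightarrow>\<^sub>M PiM W (\<lambda>_. borel)"
  unfolding observe_def by (intro measurable_restrict) measurable

lemma borel_measurable_averaged:
  assumes [measurable]: "F \<in> borel_measurable (PiM W (\<lambda>_. borel))"
  shows "averaged W f F \<in> borel_measurable (PiM W (\<lambda>_. borel))"
  unfolding averaged_def
proof (rule lborel.borel_measurable_nn_integral)
  have "(\<lambda>x. F ((\<lambda>(q, y). observe W f q y) x)) \<in> borel_measurable (PiM W (\<lambda>_. borel) \<Otimes>\<^sub>M borel)"
    by measurable
  then show "(\<lambda>(q, y). F (observe W f q y)) \<in> borel_measurable (PiM W (\<lambda>_. borel) \<Otimes>\<^sub>M lborel)"
    by (simp add: case_prod_beta cong: measurable_cong_sets)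
qed

lemma functional_averaged:
  assumes F: "functional W F"
  shows "functional W (averaged W f F)"
  unfolding functional_def
proof (intro conjI allI impI)
  show "averaged W f F \<in> borel_measurable (PiM W (\<lambda>_. borel))"
    using functionalD(1)[OF F] by (rule borel_measurable_averaged)
  have *: "observe W f (restrict q W) y = observe W f q y" for q y
    by (auto simp: observe_def)
  then show "averaged W f F (restrict q W) = averaged W f F q" for q
    by (simp add: averaged_def)
  fix c :: real and q :: "'a \<Rightarrow> real" assume c: "0 < c" and q: "\<forall>w\<in>W. 0 \<le> q w"
  have "F (observe W f (\<lambda>w. c * q w) y) = ennreal c * F (observe W f q y)" for y
  proof -
    have "F (observe W f (\<lambda>w. c * q w) y) = F (\<lambda>w. c * observe W f q y w)"
      by (rule functional_cong[OF F]) (simp add: observe_def)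
    then show ?thesis using functionalD(3)[OF F c weight_observe] q by (simp add: weight_def)
  qed
  then show "averaged W f F (\<lambda>w. c * q w) = ennreal c * averaged W f F q"
    using measurable_compose[OF measurable_observe functionalD(1)[OF F]]
    by (simp add: averaged_def nn_integral_cmult)
qed

lemma borel_measurable_gain_density [measurable]:
  "(\<lambda>(q, y). gain_density W f q y) \<in> borel_measurable (PiM W (\<lambda>_. borel) \<Otimes>\<^sub>M borel)"
  "gain_density W f q \<in> borel_measurable borel"
  unfolding gain_density_def mixture_def case_prod_beta by measurable

lemma functional_gain: "functional W (gain W f)"
  unfolding functional_def
proof (intro conjI allI impI)
  show "gain W f \<in> borel_measurable (PiM W (\<lambda>_. borel))"
    unfolding gain_def by (rule lborel.borel_measurable_nn_integral) measurable
  show "gain W f (restrict q W) = gain W f q" for q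
    by (simp add: gain_def gain_density_def mixture_def)
  fix c :: real and q :: "'a \<Rightarrow> real" assume c: "0 < c"
  have "gain_density W f (\<lambda>w. c * q w) y = c * gain_density W f q y" for y
    using c by (simp add: gain_density_def mixture_def sum_distrib_left[symmetric] mult.assoc
      mult.left_commute[of _ c])
  then show "gain W f (\<lambda>w. c * q w) = ennreal c * gain W f q"
    using c by (simp add: gain_def ennreal_mult' nn_integral_cmult)
qed

lemma functional_uncertainty: "functional W (\<lambda>q. ennreal (uncertainty W Z q))"
  unfolding functional_def
proof (intro conjI allI impI)
  have "(\<lambda>q :: 'a \<Rightarrow> real. sum q {v \<in> W. P v}) \<in> borel_measurable (PiM W (\<lambda>_. borel))" for P
    by (intro borel_measurable_sum) auto
  then show "(\<lambda>q. ennreal (uncertainty W Z q)) \<in> borel_measurable (PiM W (\<lambda>_. borel))"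
    unfolding uncertainty_def by measurable
  show "ennreal (uncertainty W Z (restrict q W)) = ennreal (uncertainty W Z q)" for q
    by (simp add: uncertainty_def)
  fix c :: real and q :: "'a \<Rightarrow> real" assume c: "0 < c"
  then have "uncertainty W Z (\<lambda>w. c * q w) = c * uncertainty W Z q"
    by (simp add: uncertainty_def sum_distrib_left[symmetric] mult.assoc)
  then show "ennreal (uncertainty W Z (\<lambda>w. c * q w)) = ennreal c * ennreal (uncertainty W Z q)"
    using c by (simp add: ennreal_mult')
qed

section \<open>Concavity and monotonicity of the gain\<close>

text \<open>The supporting linear functional of the concave function \<open>q \<mapsto> gain_density W f q y\<close>.\<close>

definition tangent :: "'w set \<Rightarrow> ('w \<Rightarrow> complex) \<Rightarrow> real \<Rightarrow> complex \<Rightarrow> ('w \<Rightarrow> real) \<Rightarrow> real" where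
  "tangent W f r y q = (\<Sum>w\<in>W. q w * (gauss (y - f w) * ln (gauss (y - f w) / r) + r - gauss (y - f w)))"

lemma tangent_eq:
  "tangent W f r y q = (\<Sum>w\<in>W. q w * (gauss (y - f w) * ln (gauss (y - f w) / r))) +
     (r * sum q W - mixture W f q y)"
  by (simp add: tangent_def mixture_def sum_distrib_left distrib_left right_diff_distrib
    sum.distrib sum_subtractf mult.commute[of r])

lemma gain_density_eq_tangent:
  assumes "finite W" "weight W q" "0 < sum q W"
  shows "gain_density W f q y = tangent W f (mixture W f q y / sum q W) y q"
  using assms(3) by (simp add: tangent_eq gain_density_def)

text \<open>With \<open>m\<close> the mixture and \<open>s\<close> the total mass, the defect is
  \<open>m * (x - 1 - ln x)\<close> at \<open>x = r * s / m\<close>. It is nonnegative, and it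
  vanishes for \<open>r = m / s\<close>.\<close>

lemma gain_density_le_tangent:
  assumes "finite W" "weight W q" "0 < r"
  shows "gain_density W f q y \<le> tangent W f r y q"
  using assms(1,2)
proof (cases rule: sum_weight_cases)
  case 1
  then show ?thesis by (simp add: tangent_def gain_density_def)
next
  case 2
  define m s where "m = mixture W f q y" and "s = sum q W"
  have pos: "0 < m" "0 < s" using mixture_pos[OF assms(1,2) 2] 2 by (auto simp: m_def s_def)
  have "gain_density W f q y =
      (\<Sum>w\<in>W. q w * gauss (y - f w) * (ln (gauss (y - f w) / r) + ln (r * s / m)))"
    unfolding gain_density_def m_def[symmetric] s_def[symmetric]
    using pos assms(3) by (intro sum.cong) (auto simp: ln_mult ln_div)
  also have "\<dots> = (\<Sum>w\<in>W. q w * (gauss (y - f w) * ln (gauss (y - f w) / r))) + m * ln (r * s / m)"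
    by (simp add: distrib_left sum.distrib m_def mixture_def sum_distrib_right mult.assoc)
  also have "m * ln (r * s / m) \<le> m * (r * s / m - 1)"
    using pos assms(3) by (intro mult_left_mono ln_le_minus_one) auto
  also have "\<dots> = r * s - m"
    using pos by (simp add: field_simps)
  finally show ?thesis by (simp add: tangent_eq m_def s_def)
qed

text \<open>Single summands of \<open>gain_density\<close> can be negative. The tangent at
  \<open>q\<close> itself adds the terms \<open>r - gauss (y - f w)\<close>, whose weighted total is
  0, and makes every summand nonnegative by \<open>ln x \<le> x - 1\<close>. Hence no truncation
  occurs in the definition of \<open>gain\<close>.\<close>

lemma gain_density_nonneg:
  assumes "finite W" "weight W q"
  shows "0 \<le> gain_density W f q y"
  using assms
proof (cases rule: sum_weight_cases)
  case 1
  then show ?thesis by (simp add: gain_density_def)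
next
  case 2
  define r where "r = mixture W f q y / sum q W"
  have r: "0 < r" unfolding r_def using mixture_pos[OF assms 2] 2 by simp
  have "0 \<le> gauss z * ln (gauss z / r) + r - gauss z" for z
  proof -
    have "gauss z * ln (r / gauss z) \<le> gauss z * (r / gauss z - 1)"
      using r by (intro mult_left_mono ln_le_minus_one) auto
    moreover have "ln (r / gauss z) = - ln (gauss z / r)" using r by (simp add: ln_div)
    ultimately show ?thesis by (simp add: algebra_simps)
  qed
  then show ?thesis
    unfolding gain_density_eq_tangent[OF assms 2] r_def[symmetric] tangent_def
    using assms(2) by (intro sum_nonneg mult_nonneg_nonneg) (auto simp: weight_def)
qed

text \<open>The tangent at the total vector dominates the gain density of every part and is linear,
  so the parts add up. In terms of information: revealing from which part \<open>w\<close> comes can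
  only lower what a noisy observation of \<open>f w\<close> tells about \<open>w\<close>.\<close>

lemma gain_superadditive:
  assumes "finite W" "finite V" and q: "\<And>v. v \<in> V \<Longrightarrow> weight W (q v)"
  shows "(\<Sum>v\<in>V. gain W f (q v)) \<le> gain W f (\<lambda>w. \<Sum>v\<in>V. q v w)"
proof -
  let ?Q = "\<lambda>w. \<Sum>v\<in>V. q v w"
  have Q: "weight W ?Q" using q by (auto simp: weight_def intro: sum_nonneg)
  have "(\<Sum>v\<in>V. gain_density W f (q v) y) \<le> gain_density W f ?Q y" for y
    using assms(1) Q
  proof (cases rule: sum_weight_cases)
    case 1
    then have "q v w = 0" if "v \<in> V" "w \<in> W" for v w
      using that q assms(2) by (auto simp: weight_def sum_nonneg_eq_0_iff)
    then show ?thesis by (simp add: gain_density_def)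
  next
    case 2
    define r where "r = mixture W f ?Q y / sum ?Q W"
    have r: "0 < r" unfolding r_def using mixture_pos[OF assms(1) Q 2] 2 by simp
    have "(\<Sum>v\<in>V. gain_density W f (q v) y) \<le> (\<Sum>v\<in>V. tangent W f r y (q v))"
      using q r assms(1) by (intro sum_mono gain_density_le_tangent) auto
    also have "\<dots> = tangent W f r y ?Q"
      unfolding tangent_def sum_distrib_right by (rule sum.swap)
    finally show ?thesis unfolding gain_density_eq_tangent[OF assms(1) Q 2] r_def .
  qed
  then have "(\<Sum>v\<in>V. ennreal (gain_density W f (q v) y)) \<le> ennreal (gain_density W f ?Q y)" for y
    using gain_density_nonneg[OF assms(1) q] by (subst sum_ennreal) (auto intro: ennreal_leI)
  then show ?thesis
    unfolding gain_def by (subst nn_integral_sum[symmetric]) (auto intro!: nn_integral_mono)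
qed

text \<open>An earlier observation can only lower the gain of a later one. This is the continuous
  form of superadditivity: \<open>q\<close> is the integral of its posteriors. Fubini puts the
  integral over the earlier observation inside, so that for fixed \<open>y\<close> a single tangent
  at \<open>q\<close> serves for all posteriors.\<close>

lemma averaged_gain_le:
  assumes W: "finite W" "weight W q"
  shows "averaged W g (gain W f) q \<le> gain W f q"
proof -
  have "averaged W g (gain W f) q =
      (\<integral>\<^sup>+z. \<integral>\<^sup>+y. ennreal (gain_density W f (observe W g q z) y) \<partial>lborel \<partial>lborel)"
    by (simp add: averaged_def gain_def)
  also have "\<dots> = (\<integral>\<^sup>+y. \<integral>\<^sup>+z. ennreal (gain_density W f (observe W g q z) y) \<partial>lborel \<partial>lborel)"
  proof (rule lborel_pair.Fubini'[symmetric])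
    have "(\<lambda>x. (\<lambda>(q, y). gain_density W f q y) (observe W g q (fst x), snd x)) \<in> borel_measurable (borel \<Otimes>\<^sub>M borel)"
      by measurable
    then show "(\<lambda>(z, y). ennreal (gain_density W f (observe W g q z) y)) \<in> borel_measurable (lborel \<Otimes>\<^sub>M lborel)"
      by (simp add: case_prod_beta cong: measurable_cong_sets)
  qed
  also have "\<dots> \<le> (\<integral>\<^sup>+y. ennreal (gain_density W f q y) \<partial>lborel)"
  proof (rule nn_integral_mono)
    fix y
    show "(\<integral>\<^sup>+z. ennreal (gain_density W f (observe W g q z) y) \<partial>lborel) \<le> ennreal (gain_density W f q y)"
      using W
    proof (cases rule: sum_weight_cases)
      case 1
      then show ?thesis by (simp add: gain_density_def observe_def)
    next
      case 2
      define r where "r = mixture W f q y / sum q W"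
      have r: "0 < r" unfolding r_def using mixture_pos[OF W 2] 2 by simp
      define c where "c w = q w * (gauss (y - f w) * ln (gauss (y - f w) / r) + r - gauss (y - f w))" for w
      have t: "tangent W f r y (observe W g q z) = (\<Sum>w\<in>W. c w * gauss (z - g w))" for z
        by (simp add: tangent_def observe_def c_def mult_ac)
      have le: "gain_density W f (observe W g q z) y \<le> (\<Sum>w\<in>W. c w * gauss (z - g w))" for z
        unfolding t[symmetric] using W r weight_observe by (intro gain_density_le_tangent) auto
      have "(\<integral>\<^sup>+z. ennreal (gain_density W f (observe W g q z) y) \<partial>lborel)
         \<le> (\<integral>\<^sup>+z. ennreal (\<Sum>w\<in>W. c w * gauss (z - g w)) \<partial>lborel)"
        using le by (intro nn_integral_mono ennreal_leI)
      also have "\<dots> = ennreal (\<Sum>w\<in>W. c w)"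
        using order_trans[OF gain_density_nonneg[OF W(1) weight_observe[OF W(2)]] le]
        by (rule nn_integral_gauss_sum)
      also have "(\<Sum>w\<in>W. c w) = gain_density W f q y"
        unfolding gain_density_eq_tangent[OF W 2] r_def[symmetric] by (simp add: tangent_def c_def)
      finally show ?thesis .
    qed
  qed
  finally show ?thesis by (simp add: gain_def)
qed

section \<open>Chain rule for discrete entropy\<close>

lemma uncertainty_nonneg:
  assumes "finite W" "weight W q"
  shows "0 \<le> uncertainty W Z q"
  unfolding uncertainty_def
proof (rule sum_nonneg)
  fix w assume w: "w \<in> W"
  show "0 \<le> q w * ln (sum q W / sum q {v \<in> W. Z v = Z w})"
  proof (cases "q w = 0")
    case False
    then have "0 < q w" using assms(2) w by (auto simp: weight_def less_le)
    also have "q w \<le> sum q {v \<in> W. Z v = Z w}"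
      using assms w by (intro member_le_sum) (auto simp: weight_def)
    finally have "0 < sum q {v \<in> W. Z v = Z w}" .
    moreover have "sum q {v \<in> W. Z v = Z w} \<le> sum q W"
      using assms by (intro sum_mono2) (auto simp: weight_def)
    ultimately show ?thesis using \<open>0 < q w\<close> by simp
  qed simp
qed

text \<open>Since \<open>f\<close> is constant on the fibres of \<open>Z\<close>, an observation
  multiplies the mass of a fibre by a single Gaussian factor. The logarithms therefore combine
  pointwise in \<open>y\<close>, and integration over \<open>y\<close> removes the factor
  \<open>gauss (y - f w)\<close>.\<close>

lemma uncertainty_split:
  assumes W: "finite W" "weight W q"
    and Z: "\<And>w v. w \<in> W \<Longrightarrow> v \<in> W \<Longrightarrow> Z w = Z v \<Longrightarrow> f w = f v"
  shows "ennreal (uncertainty W Z q) = gain W f q + averaged W f (\<lambda>q. ennreal (uncertainty W Z q)) q"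
proof -
  define c where "c w = q w * ln (sum q W / sum q {v\<in>W. Z v = Z w})" for w
  have pt: "(\<Sum>w\<in>W. c w * gauss (y - f w)) = gain_density W f q y + uncertainty W Z (observe W f q y)" for y
    using W
  proof (cases rule: sum_weight_cases)
    case 1
    then show ?thesis by (simp add: c_def gain_density_def uncertainty_def observe_def)
  next
    case 2
    define m where "m = mixture W f q y"
    have m: "0 < m" unfolding m_def by (rule mixture_pos[OF W 2])
    have "c w * gauss (y - f w) = q w * (gauss (y - f w) * ln (gauss (y - f w) * sum q W / m)) +
       observe W f q y w * ln (m / sum (observe W f q y) {v\<in>W. Z v = Z w})" if w: "w \<in> W" for w
    proof (cases "q w = 0")
      case False
      then have "0 < q w" using W w by (auto simp: weight_def less_le)
      also have "q w \<le> sum q {v \<in> W. Z v = Z w}"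
        using W w by (intro member_le_sum) (auto simp: weight_def)
      finally have z: "0 < sum q {v \<in> W. Z v = Z w}" .
      have "sum (observe W f q y) {v\<in>W. Z v = Z w} = (\<Sum>v\<in>{v\<in>W. Z v = Z w}. q v * gauss (y - f w))"
        using Z[OF _ w] by (intro sum.cong) (auto simp: observe_def)
      also have "\<dots> = sum q {v\<in>W. Z v = Z w} * gauss (y - f w)" by (simp add: sum_distrib_right)
      finally show ?thesis using w z m 2
        by (simp add: c_def observe_def ln_div ln_mult algebra_simps)
    qed (simp add: c_def observe_def w)
    then show ?thesis
      by (simp add: gain_density_def uncertainty_def mixture_eq_sum_observe[symmetric] m_def[symmetric]
        sum.distrib)
  qed
  have "ennreal (uncertainty W Z q) = ennreal (\<Sum>w\<in>W. c w)"
    by (simp add: uncertainty_def c_def)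
  also have "\<dots> = (\<integral>\<^sup>+y. ennreal (\<Sum>w\<in>W. c w * gauss (y - f w)) \<partial>lborel)"
    unfolding pt using W
    by (subst nn_integral_gauss_sum[symmetric, where f = f])
      (auto simp: pt intro!: add_nonneg_nonneg gain_density_nonneg uncertainty_nonneg weight_observe)
  also have "\<dots> = (\<integral>\<^sup>+y. ennreal (gain_density W f q y) + ennreal (uncertainty W Z (observe W f q y)) \<partial>lborel)"
    unfolding pt using W
    by (intro nn_integral_cong ennreal_plus gain_density_nonneg uncertainty_nonneg weight_observe)
  also have "\<dots> = gain W f q + averaged W f (\<lambda>q. ennreal (uncertainty W Z q)) q"
    unfolding gain_def averaged_def
    using measurable_compose[OF measurable_observe functionalD(1)[OF functional_uncertainty]]
    by (intro nn_integral_add) auto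
  finally show ?thesis .
qed

section \<open>Changes of variables and rotation of the noise\<close>

lemma nn_integral_shear:
  fixes H :: "complex \<Rightarrow> complex \<Rightarrow> ennreal"
  assumes [measurable]: "(\<lambda>(y, z). H y z) \<in> borel_measurable (borel \<Otimes>\<^sub>M borel)"
  shows "(\<integral>\<^sup>+y. \<integral>\<^sup>+z. H y (z + s * y) \<partial>lborel \<partial>lborel) = (\<integral>\<^sup>+y. \<integral>\<^sup>+z. H y z \<partial>lborel \<partial>lborel)"
    and "(\<integral>\<^sup>+y. \<integral>\<^sup>+z. H (y + s * z) z \<partial>lborel \<partial>lborel) = (\<integral>\<^sup>+y. \<integral>\<^sup>+z. H y z \<partial>lborel \<partial>lborel)"
proof -
  have [measurable]: "(\<lambda>z. H y z) \<in> borel_measurable borel" "(\<lambda>y. H y z) \<in> borel_measurable borel" for y z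
    using measurable_compose[OF measurable_Pair1' assms, of y] measurable_compose[OF measurable_Pair2' assms, of z]
    by (simp_all add: space_borel)
  show "(\<integral>\<^sup>+y. \<integral>\<^sup>+z. H y (z + s * y) \<partial>lborel \<partial>lborel) = (\<integral>\<^sup>+y. \<integral>\<^sup>+z. H y z \<partial>lborel \<partial>lborel)"
    by (simp add: nn_integral_lborel_shift)
  have "(\<lambda>x. (\<lambda>(y, z). H y z) (fst x + s * snd x, snd x)) \<in> borel_measurable (borel \<Otimes>\<^sub>M borel)"
    by measurable
  then have "(\<integral>\<^sup>+y. \<integral>\<^sup>+z. H (y + s * z) z \<partial>lborel \<partial>lborel) = (\<integral>\<^sup>+z. \<integral>\<^sup>+y. H (y + s * z) z \<partial>lborel \<partial>lborel)"
    by (intro lborel_pair.Fubini'[symmetric]) (simp add: case_prod_beta cong: measurable_cong_sets)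
  also have "\<dots> = (\<integral>\<^sup>+z. \<integral>\<^sup>+y. H y z \<partial>lborel \<partial>lborel)"
    by (intro nn_integral_cong nn_integral_lborel_shift[where f = "\<lambda>y. H y z" for z]) measurable
  also have "\<dots> = (\<integral>\<^sup>+y. \<integral>\<^sup>+z. H y z \<partial>lborel \<partial>lborel)"
    using assms by (intro lborel_pair.Fubini') (simp add: case_prod_beta cong: measurable_cong_sets)
  finally show "(\<integral>\<^sup>+y. \<integral>\<^sup>+z. H (y + s * z) z \<partial>lborel \<partial>lborel) = (\<integral>\<^sup>+y. \<integral>\<^sup>+z. H y z \<partial>lborel \<partial>lborel)" .
qed

text \<open>A matrix of determinant 1 with nonzero lower left entry is a product of three shears.\<close>

lemma nn_integral_SL2:
  fixes H :: "complex \<Rightarrow> complex \<Rightarrow> ennreal"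
  assumes H: "(\<lambda>(y, z). H y z) \<in> borel_measurable (borel \<Otimes>\<^sub>M borel)"
    and det: "a * d - b * c = 1"
  shows "(\<integral>\<^sup>+y. \<integral>\<^sup>+z. H (a * y + b * z) (c * y + d * z) \<partial>lborel \<partial>lborel) =
    (\<integral>\<^sup>+y. \<integral>\<^sup>+z. H y z \<partial>lborel \<partial>lborel)"
proof -
  have *: "(\<integral>\<^sup>+y. \<integral>\<^sup>+z. H (a * y + b * z) (c * y + d * z) \<partial>lborel \<partial>lborel) =
      (\<integral>\<^sup>+y. \<integral>\<^sup>+z. H y z \<partial>lborel \<partial>lborel)"
    if H: "(\<lambda>(y, z). H y z) \<in> borel_measurable (borel \<Otimes>\<^sub>M borel)"
      and det: "a * d - b * c = 1" and c: "c \<noteq> 0"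
    for H :: "complex \<Rightarrow> complex \<Rightarrow> ennreal" and a b c d
  proof -
    \<comment> \<open>The factors are upper, lower and upper unitriangular with entries
      \<open>p\<close>, \<open>c\<close> and \<open>r\<close>. Comparing diagonal entries gives
      \<open>p\<close> and \<open>r\<close>; the determinant then forces the entry
      \<open>b\<close>.\<close>
    define r p where "r = (d - 1) / c" and "p = (a - 1) / c"
    define H1 where "H1 y z = H (y + p * z) z" for y z
    define H2 where "H2 y z = H1 y (z + c * y)" for y z
    have [measurable]: "(\<lambda>x. H (fst x) (snd x)) \<in> borel_measurable (borel \<Otimes>\<^sub>M borel)"
      using H by (simp add: case_prod_beta)
    have "(\<lambda>x. (\<lambda>x. H (fst x) (snd x)) (fst x + p * snd x, snd x)) \<in> borel_measurable (borel \<Otimes>\<^sub>M borel)"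
      by measurable
    then have H1: "(\<lambda>(y, z). H1 y z) \<in> borel_measurable (borel \<Otimes>\<^sub>M borel)"
      by (simp add: H1_def case_prod_beta)
    then have [measurable]: "(\<lambda>x. H1 (fst x) (snd x)) \<in> borel_measurable (borel \<Otimes>\<^sub>M borel)"
      by (simp add: case_prod_beta)
    have "(\<lambda>x. (\<lambda>x. H1 (fst x) (snd x)) (fst x, snd x + c * fst x)) \<in> borel_measurable (borel \<Otimes>\<^sub>M borel)"
      by measurable
    then have H2: "(\<lambda>(y, z). H2 y z) \<in> borel_measurable (borel \<Otimes>\<^sub>M borel)"
      by (simp add: H2_def case_prod_beta)
    have cr: "c * r = d - 1" and cp: "c * p = a - 1" using c by (simp_all add: r_def p_def)
    have "c * (r + p * d) = c * b" using det by (simp add: distrib_left cr cp[unfolded mult.commute[of c]]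
        mult.assoc[symmetric] cp algebra_simps)
    then have b: "r + p * d = b" using c by simp
    have "H2 (y + r * z) z = H (a * y + b * z) (c * y + d * z)" for y z
    proof -
      have 1: "z + c * (y + r * z) = c * y + d * z"
        by (simp add: distrib_left mult.assoc[symmetric] cr algebra_simps)
      have "y + r * z + p * (c * y + d * z) = (1 + c * p) * y + (r + p * d) * z"
        by (simp add: algebra_simps)
      then show ?thesis unfolding H2_def H1_def 1 by (simp add: cp b)
    qed
    then show ?thesis
      using nn_integral_shear(2)[OF H2, of r] nn_integral_shear(1)[OF H1, of c] nn_integral_shear(2)[OF H, of p]
      by (simp add: H1_def H2_def)
  qed
  show ?thesis
  proof (cases "c = 0")
    case False
    then show ?thesis using *[OF H det] by blast
  next
    \<comment> \<open>Composition with the quarter turn, which sends \<open>(y, z)\<close> to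
      \<open>(- z, y)\<close> and has lower left entry 1, moves \<open>d \<noteq> 0\<close> into the
      lower left corner, so the first case applies twice.\<close>
    case True
    then have d: "d \<noteq> 0" using det by auto
    have [measurable]: "(\<lambda>x. H (fst x) (snd x)) \<in> borel_measurable (borel \<Otimes>\<^sub>M borel)"
      using H by (simp add: case_prod_beta)
    have "(\<lambda>x. (\<lambda>x. H (fst x) (snd x)) (a * fst x + b * snd x, d * snd x)) \<in> borel_measurable (borel \<Otimes>\<^sub>M borel)"
      by measurable
    then have "(\<integral>\<^sup>+y. \<integral>\<^sup>+z. H (a * y + b * z) (d * z) \<partial>lborel \<partial>lborel) =
      (\<integral>\<^sup>+y. \<integral>\<^sup>+z. H (a * (0 * y + (-1) * z) + b * (1 * y + 0 * z)) (d * (1 * y + 0 * z)) \<partial>lborel \<partial>lborel)"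
      by (intro *[symmetric, where H = "\<lambda>y z. H (a * y + b * z) (d * z)"]) (auto simp: case_prod_beta)
    also have "\<dots> = (\<integral>\<^sup>+y. \<integral>\<^sup>+z. H (b * y + (- a) * z) (d * y + 0 * z) \<partial>lborel \<partial>lborel)"
      by (simp add: algebra_simps)
    also have "\<dots> = (\<integral>\<^sup>+y. \<integral>\<^sup>+z. H y z \<partial>lborel \<partial>lborel)"
      using det d True by (intro *[OF H]) auto
    finally show ?thesis using True by simp
  qed
qed

lemma gauss_mult: "gauss x * gauss y = exp (- ((cmod x)\<^sup>2 + (cmod y)\<^sup>2) / 2) / (2 * pi)\<^sup>2"
  by (simp add: gauss_def exp_add[symmetric] power2_eq_square add_divide_distrib)

text \<open>Observing pure noise only rescales the weights by \<open>gauss y\<close>, which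
  homogeneity pulls out and the integral turns into 1.\<close>

lemma averaged_const_0:
  assumes F: "functional W F" and q: "weight W q"
  shows "averaged W (\<lambda>_. 0) F q = F q"
proof -
  have "F (observe W (\<lambda>_. 0) q y) = ennreal (gauss y) * F q" for y
  proof -
    have "F (observe W (\<lambda>_. 0) q y) = F (\<lambda>w. gauss y * q w)"
      by (rule functional_cong[OF F]) (simp add: observe_def mult.commute)
    then show ?thesis using functionalD(3)[OF F _ q] by simp
  qed
  then show ?thesis by (simp add: averaged_def nn_integral_multc nn_integral_gauss)
qed

text \<open>The unitary matrix with rows \<open>(\<alpha>, \<beta>)\<close> and
  \<open>(- cnj \<beta>, cnj \<alpha>)\<close> maps \<open>(a, b)\<close> to \<open>(s, 0)\<close>
  and preserves the product of two Gaussian densities. The rotated pair consists of one observation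
  of strength \<open>s\<close> and one of pure noise. The case \<open>s = 0\<close> is separate
  because of the division by \<open>s\<close>.\<close>

lemma averaged_rotate:
  assumes F: "functional W F" and q: "weight W q"
  shows "averaged W (\<lambda>w. x w * a) (averaged W (\<lambda>w. x w * b) F) q =
    averaged W (\<lambda>w. x w * of_real (sqrt ((cmod a)\<^sup>2 + (cmod b)\<^sup>2))) F q"
proof (cases "a = 0 \<and> b = 0")
  case True
  then show ?thesis using averaged_const_0[OF functional_averaged[OF F] q]
    by (simp add: averaged_const_0[OF F q])
next
  case False
  define s where "s = sqrt ((cmod a)\<^sup>2 + (cmod b)\<^sup>2)"
  have s: "0 < s" using False by (auto simp: s_def sum_power2_gt_zero_iff)
  have s2: "s\<^sup>2 = (cmod a)\<^sup>2 + (cmod b)\<^sup>2" by (simp add: s_def)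
  have s2c: "complex_of_real s * complex_of_real s = cnj a * a + cnj b * b"
    using arg_cong[OF s2, of complex_of_real] unfolding of_real_add complex_norm_square
    by (simp add: power2_eq_square mult.commute)
  define \<alpha> \<beta> where "\<alpha> = cnj a / s" and "\<beta> = cnj b / s"
  have det: "\<alpha> * cnj \<alpha> - \<beta> * (- cnj \<beta>) = 1"
  proof -
    have "\<alpha> * cnj \<alpha> - \<beta> * (- cnj \<beta>) = (cnj a * a + cnj b * b) / (of_real s * of_real s)"
      by (simp add: \<alpha>_def \<beta>_def add_divide_distrib)
    then show ?thesis unfolding s2c[symmetric] using s by simp
  qed
  have xs: "\<alpha> * (v * a) + \<beta> * (v * b) = v * s" for v
  proof -
    have "\<alpha> * (v * a) + \<beta> * (v * b) = v * (cnj a * a + cnj b * b) / s"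
      by (simp add: \<alpha>_def \<beta>_def add_divide_distrib algebra_simps)
    then show ?thesis using s by (simp add: s2c[symmetric])
  qed
  have x0: "- cnj \<beta> * (v * a) + cnj \<alpha> * (v * b) = 0" for v
    by (simp add: \<alpha>_def \<beta>_def)
  have norm: "(cmod (\<alpha> * y + \<beta> * z))\<^sup>2 + (cmod (- cnj \<beta> * y + cnj \<alpha> * z))\<^sup>2 = (cmod y)\<^sup>2 + (cmod z)\<^sup>2" for y z
  proof -
    have "complex_of_real ((cmod (\<alpha> * y + \<beta> * z))\<^sup>2 + (cmod (- cnj \<beta> * y + cnj \<alpha> * z))\<^sup>2) =
      (\<alpha> * cnj \<alpha> - \<beta> * (- cnj \<beta>)) * (y * cnj y + z * cnj z)"
      by (simp add: complex_norm_square algebra_simps del: of_real_power)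
    also have "\<dots> = complex_of_real ((cmod y)\<^sup>2 + (cmod z)\<^sup>2)"
      unfolding det by (simp add: complex_norm_square del: of_real_power)
    finally show ?thesis by (simp only: of_real_eq_iff)
  qed
  define H where "H y z = F (observe W (\<lambda>_. 0) (observe W (\<lambda>w. x w * s) q y) z)" for y z
  have obs: "F (observe W (\<lambda>w. x w * b) (observe W (\<lambda>w. x w * a) q y) z) =
      H (\<alpha> * y + \<beta> * z) (- cnj \<beta> * y + cnj \<alpha> * z)" for y z
    unfolding H_def
  proof (rule functional_cong[OF F])
    fix w assume w: "w \<in> W"
    have "gauss (y - x w * a) * gauss (z - x w * b) =
      gauss (\<alpha> * (y - x w * a) + \<beta> * (z - x w * b)) * gauss (- cnj \<beta> * (y - x w * a) + cnj \<alpha> * (z - x w * b))"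
      unfolding gauss_mult norm ..
    also have "\<alpha> * (y - x w * a) + \<beta> * (z - x w * b) = \<alpha> * y + \<beta> * z - x w * s"
      using xs[of "x w"] by (simp add: algebra_simps)
    also have "- cnj \<beta> * (y - x w * a) + cnj \<alpha> * (z - x w * b) = - cnj \<beta> * y + cnj \<alpha> * z -
        (- cnj \<beta> * (x w * a) + cnj \<alpha> * (x w * b))"
      by (simp add: algebra_simps)
    also note x0
    also have "- cnj \<beta> * y + cnj \<alpha> * z - 0 = - cnj \<beta> * y + cnj \<alpha> * z" by simp
    finally show "observe W (\<lambda>w. x w * b) (observe W (\<lambda>w. x w * a) q y) z w =
      observe W (\<lambda>_. 0) (observe W (\<lambda>w. x w * s) q (\<alpha> * y + \<beta> * z)) (- cnj \<beta> * y + cnj \<alpha> * z) w"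
      using w by (simp add: observe_def)
  qed
  have [measurable]: "F \<in> borel_measurable (PiM W (\<lambda>_. borel))" by (rule functionalD(1)[OF F])
  have "(\<lambda>v. F ((\<lambda>(q, y). observe W (\<lambda>_. 0) q y) (observe W (\<lambda>w. x w * s) q (fst v), snd v)))
      \<in> borel_measurable (borel \<Otimes>\<^sub>M borel)" by measurable
  then have "(\<lambda>(y, z). H y z) \<in> borel_measurable (borel \<Otimes>\<^sub>M borel)"
    by (simp add: H_def case_prod_beta)
  then have "averaged W (\<lambda>w. x w * a) (averaged W (\<lambda>w. x w * b) F) q = (\<integral>\<^sup>+y. \<integral>\<^sup>+z. H y z \<partial>lborel \<partial>lborel)"
    unfolding averaged_def obs by (rule nn_integral_SL2) (rule det)
  also have "\<dots> = averaged W (\<lambda>w. x w * s) (averaged W (\<lambda>_. 0) F) q"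
    by (simp add: averaged_def H_def)
  also have "\<dots> = averaged W (\<lambda>w. x w * s) F q"
    unfolding averaged_def[of W "\<lambda>w. x w * s"]
    by (simp add: averaged_const_0[OF F] weight_observe q)
  finally show ?thesis by (simp add: s_def)
qed

lemma averaged_mono:
  assumes "weight W q" "\<And>q'. weight W q' \<Longrightarrow> F q' \<le> G q'"
  shows "averaged W f F q \<le> averaged W f G q"
  unfolding averaged_def using assms(1) by (intro nn_integral_mono assms(2) weight_observe)

lemma averaged_cong:
  assumes "weight W q" "\<And>q'. weight W q' \<Longrightarrow> F q' = G q'"
  shows "averaged W f F q = averaged W f G q"
  unfolding averaged_def using assms(1) by (intro nn_integral_cong assms(2) weight_observe)

text \<open>A constant offset is a translation of \<open>y\<close>. Agreement is asked for on the
  support of \<open>q\<close> only, because with all but one coordinate fixed the observations are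
  affine only on that support.\<close>

lemma averaged_affine:
  assumes F: "functional W F" and q: "weight W q"
    and f: "\<And>w. w \<in> W \<Longrightarrow> q w \<noteq> 0 \<Longrightarrow> f w = g w + c"
  shows "averaged W f F q = averaged W g F q"
proof -
  have [measurable]: "F \<in> borel_measurable (PiM W (\<lambda>_. borel))" by (rule functionalD(1)[OF F])
  have "observe W f q y = observe W g q (y - c)" for y
  proof
    fix w
    show "observe W f q y w = observe W g q (y - c) w"
      using f[of w] by (cases "q w = 0") (auto simp: observe_def algebra_simps)
  qed
  then have "averaged W f F q = (\<integral>\<^sup>+y. F (observe W g q (y + (- c))) \<partial>lborel)"
    by (simp add: averaged_def)
  also have "\<dots> = averaged W g F q"
    unfolding averaged_def by (intro nn_integral_lborel_shift) measurable
  finally show ?thesis .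
qed

lemma gain_affine:
  assumes f: "\<And>w. w \<in> W \<Longrightarrow> q w \<noteq> 0 \<Longrightarrow> f w = g w + c"
  shows "gain W f q = gain W g q"
proof -
  have *: "q w * h (y - f w) = q w * h (y - c - g w)" if "w \<in> W" for w y and h :: "complex \<Rightarrow> real"
    using f[OF that] by (cases "q w = 0") (auto simp: algebra_simps)
  have mix: "mixture W f q y = mixture W g q (y - c)" for y
    unfolding mixture_def by (intro sum.cong refl *)
  have "gain_density W f q y = gain_density W g q (y - c)" for y
    unfolding gain_density_def mix
    by (intro sum.cong refl *[where h = "\<lambda>z. gauss z * ln (gauss z * sum q W / mixture W g q (y - c))"])
  then have "gain W f q = (\<integral>\<^sup>+y. ennreal (gain_density W g q (y + (- c))) \<partial>lborel)"
    by (simp add: gain_def)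
  also have "\<dots> = gain W g q"
    unfolding gain_def by (intro nn_integral_lborel_shift) measurable
  finally show ?thesis .
qed

section \<open>Sequences of observations\<close>

fun observed ::
    "'w set \<Rightarrow> ('w \<Rightarrow> complex) list \<Rightarrow> (('w \<Rightarrow> real) \<Rightarrow> ennreal) \<Rightarrow> ('w \<Rightarrow> real) \<Rightarrow> ennreal" where
  "observed W [] F = F"
| "observed W (f # fs) F = averaged W f (observed W fs F)"

lemma functional_observed: "functional W F \<Longrightarrow> functional W (observed W fs F)"
  by (induction fs) (auto intro: functional_averaged)

lemma observed_append: "observed W (fs @ gs) F = observed W fs (observed W gs F)"
  by (induction fs) auto

lemma observed_mono:
  assumes "\<And>q'. weight W q' \<Longrightarrow> F q' \<le> G q'"
  shows "weight W q \<Longrightarrow> observed W fs F q \<le> observed W fs G q"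
  by (induction fs arbitrary: q) (auto intro: assms averaged_mono)

text \<open>\<open>uncertainty_split\<close> is applied to each observation in turn; the uncertainty
  left after the last one is dropped, which makes this an inequality.\<close>

lemma sum_gain_le_uncertainty:
  assumes "finite W" "weight W q"
    and "\<And>f w v. f \<in> set fs \<Longrightarrow> w \<in> W \<Longrightarrow> v \<in> W \<Longrightarrow> Z w = Z v \<Longrightarrow> f w = f v"
  shows "(\<Sum>l<length fs. observed W (take l fs) (gain W (fs ! l)) q) \<le> ennreal (uncertainty W Z q)"
  using assms(2,3)
proof (induction fs arbitrary: q)
  case Nil
  then show ?case by simp
next
  case (Cons f fs)
  have meas: "(\<lambda>y. observed W gs (gain W g) (observe W f q y)) \<in> borel_measurable borel" for gs g
    by (rule measurable_compose[OF measurable_observe functionalD(1)[OF functional_observed[OF functional_gain]]])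
  have "(\<Sum>l<length fs. averaged W f (observed W (take l fs) (gain W (fs ! l))) q) =
    averaged W f (\<lambda>q. \<Sum>l<length fs. observed W (take l fs) (gain W (fs ! l)) q) q"
    unfolding averaged_def by (subst nn_integral_sum) (auto intro: meas)
  also have "\<dots> \<le> averaged W f (\<lambda>q. ennreal (uncertainty W Z q)) q"
    using Cons by (intro averaged_mono) auto
  finally have "(\<Sum>l<length (f # fs). observed W (take l (f # fs)) (gain W ((f # fs) ! l)) q) \<le>
    gain W f q + averaged W f (\<lambda>q. ennreal (uncertainty W Z q)) q"
    by (simp add: sum.lessThan_Suc_shift add_left_mono del: sum.lessThan_Suc)
  also have "\<dots> = ennreal (uncertainty W Z q)"
    using Cons.prems by (intro uncertainty_split[OF assms(1), symmetric]) auto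
  finally show ?case .
qed

text \<open>\<open>observe\<close> is linear in the weights, so superadditivity passes through every
  earlier observation.\<close>

lemma observed_gain_superadditive:
  assumes W: "finite W" "finite V" and q: "\<And>v. v \<in> V \<Longrightarrow> weight W (q v)"
  shows "(\<Sum>v\<in>V. observed W fs (gain W f) (q v)) \<le> observed W fs (gain W f) (\<lambda>w. \<Sum>v\<in>V. q v w)"
  using q
proof (induction fs arbitrary: q)
  case Nil
  then show ?case using gain_superadditive[OF W] by simp
next
  case (Cons g fs)
  let ?F = "observed W fs (gain W f)"
  have F: "functional W ?F" by (intro functional_observed functional_gain)
  have "(\<Sum>v\<in>V. observed W (g # fs) (gain W f) (q v)) =
    (\<integral>\<^sup>+y. (\<Sum>v\<in>V. ?F (observe W g (q v) y)) \<partial>lborel)"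
    using measurable_compose[OF measurable_observe functionalD(1)[OF F]]
    by (simp add: averaged_def nn_integral_sum)
  also have "\<dots> \<le> (\<integral>\<^sup>+y. ?F (observe W g (\<lambda>w. \<Sum>v\<in>V. q v w) y) \<partial>lborel)"
  proof (rule nn_integral_mono)
    fix y
    have "(\<Sum>v\<in>V. ?F (observe W g (q v) y)) \<le> ?F (\<lambda>w. \<Sum>v\<in>V. observe W g (q v) y w)"
      using Cons.prems by (intro Cons.IH weight_observe)
    also have "\<dots> = ?F (observe W g (\<lambda>w. \<Sum>v\<in>V. q v w) y)"
      by (rule functional_cong[OF F]) (simp add: observe_def sum_distrib_right)
    finally show "(\<Sum>v\<in>V. ?F (observe W g (q v) y)) \<le> ?F (observe W g (\<lambda>w. \<Sum>v\<in>V. q v w) y)" .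
  qed
  finally show ?case by (simp add: averaged_def)
qed

text \<open>A posterior vanishes wherever its prior does. Hence the affine form of the observations,
  and the agreement of \<open>F\<close> and \<open>G\<close>, are only required on the support of
  the initial \<open>q\<close>.\<close>

lemma observed_affine:
  assumes "functional W F" "functional W G" "weight W q" "length bs = length fs"
    and "\<And>i w. i < length fs \<Longrightarrow> w \<in> W \<Longrightarrow> q w \<noteq> 0 \<Longrightarrow> (fs ! i) w = x w * bs ! i + c i"
    and "\<And>q'. weight W q' \<Longrightarrow> (\<And>w. w \<in> W \<Longrightarrow> q w = 0 \<Longrightarrow> q' w = 0) \<Longrightarrow> F q' = G q'"
  shows "observed W fs F q = observed W (map (\<lambda>b w. x w * b) bs) G q"
  using assms(3-)
proof (induction fs arbitrary: bs c q)
  case Nil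
  then show ?case by simp
next
  case (Cons f fs)
  then obtain b bs' where bs: "bs = b # bs'" "length bs' = length fs" by (cases bs) auto
  have "observed W (f # fs) F q = averaged W (\<lambda>w. x w * b) (observed W fs F) q"
    using Cons.prems(3)[of 0] bs
    by (auto intro!: averaged_affine[where c = "c 0"] functional_observed assms Cons.prems)
  also have "\<dots> = averaged W (\<lambda>w. x w * b) (observed W (map (\<lambda>b w. x w * b) bs') G) q"
    unfolding averaged_def
  proof (intro nn_integral_cong Cons.IH)
    fix y i w assume "i < length fs" "w \<in> W" "observe W (\<lambda>w. x w * b) q y w \<noteq> 0"
    then show "(fs ! i) w = x w * bs' ! i + c (Suc i)"
      using Cons.prems(3)[of "Suc i" w] bs by (auto simp: observe_def)
  next
    fix y q' assume "weight W q'" "\<And>w. w \<in> W \<Longrightarrow> observe W (\<lambda>w. x w * b) q y w = 0 \<Longrightarrow> q' w = 0"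
    then show "F q' = G q'" by (intro Cons.prems(4)) (auto simp: observe_def)
  qed (use Cons.prems bs weight_observe in auto)
  finally show ?case by (simp add: bs)
qed

lemma observed_rotate:
  assumes F: "functional W F" and "0 \<le> d"
  shows "weight W q \<Longrightarrow> observed W (map (\<lambda>b w. x w * b) bs @ [\<lambda>w. x w * of_real d]) F q =
    averaged W (\<lambda>w. x w * of_real (sqrt ((\<Sum>b\<leftarrow>bs. (cmod b)\<^sup>2) + d\<^sup>2))) F q"
proof (induction bs arbitrary: q)
  case Nil
  then show ?case using assms by simp
next
  case (Cons b bs)
  let ?s = "(\<Sum>b\<leftarrow>bs. (cmod b)\<^sup>2) + d\<^sup>2"
  have s: "0 \<le> ?s" by (intro add_nonneg_nonneg sum_list_nonneg) auto
  have "observed W (map (\<lambda>b w. x w * b) (b # bs) @ [\<lambda>w. x w * of_real d]) F q =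
    averaged W (\<lambda>w. x w * b) (averaged W (\<lambda>w. x w * of_real (sqrt ?s)) F) q"
    using Cons by (auto intro: averaged_cong)
  also have "\<dots> = averaged W (\<lambda>w. x w * of_real (sqrt ((cmod b)\<^sup>2 + ?s))) F q"
    using s by (subst averaged_rotate[OF F Cons.prems]) simp
  finally show ?case by (simp add: add.assoc)
qed

text \<open>Completing the observations to total strength \<open>t\<close> by one more observation can only reduce the
  gain; after a rotation, a single observation of strength \<open>t\<close> remains.\<close>

lemma averaged_gain_le_observed:
  assumes W: "finite W" "weight W q" and t: "(\<Sum>b\<leftarrow>bs. (cmod b)\<^sup>2) \<le> t\<^sup>2" "0 \<le> t"
  shows "averaged W (\<lambda>w. x w * of_real t) (gain W f) q \<le> observed W (map (\<lambda>b w. x w * b) bs) (gain W f) q"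
proof -
  define d where "d = sqrt (t\<^sup>2 - (\<Sum>b\<leftarrow>bs. (cmod b)\<^sup>2))"
  have "sqrt ((\<Sum>b\<leftarrow>bs. (cmod b)\<^sup>2) + d\<^sup>2) = t" using t by (simp add: d_def)
  then have "averaged W (\<lambda>w. x w * of_real t) (gain W f) q =
    observed W (map (\<lambda>b w. x w * b) bs @ [\<lambda>w. x w * of_real d]) (gain W f) q"
    using observed_rotate[OF functional_gain, of d W q x bs f] t W by (simp add: d_def)
  also have "\<dots> \<le> observed W (map (\<lambda>b w. x w * b) bs) (gain W f) q"
    unfolding observed_append using averaged_gain_le[OF W(1)] W(2) by (auto intro: observed_mono)
  finally show ?thesis .
qed

text \<open>Both sides are the loss of uncertainty about \<open>w\<close> itself, so
  \<open>uncertainty_split\<close> is used with \<open>Z\<close> the identity. By rotation the same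
  uncertainty \<open>?C\<close> remains after the two observations and after the single one; it is
  finite and can be cancelled.\<close>

lemma averaged_gain_chain:
  assumes W: "finite W" "weight W q"
  shows "averaged W (\<lambda>w. x w * a) (gain W (\<lambda>w. x w * b)) q + gain W (\<lambda>w. x w * a) q =
    gain W (\<lambda>w. x w * of_real (sqrt ((cmod a)\<^sup>2 + (cmod b)\<^sup>2))) q"
proof -
  let ?V = "\<lambda>q. ennreal (uncertainty W (\<lambda>w. w) q)"
  let ?s = "sqrt ((cmod a)\<^sup>2 + (cmod b)\<^sup>2)"
  let ?C = "averaged W (\<lambda>w. x w * of_real ?s) ?V q"
  have V: "?V q' = gain W f q' + averaged W f ?V q'" if "weight W q'" for f q'
    using W(1) that by (rule uncertainty_split) simp
  have meas: "(\<lambda>y. F (observe W f q y)) \<in> borel_measurable lborel" if "functional W F" for F f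
    using measurable_compose[OF measurable_observe functionalD(1)[OF that]] by simp
  have "averaged W (\<lambda>w. x w * a) ?V q =
    averaged W (\<lambda>w. x w * a) (\<lambda>q. gain W (\<lambda>w. x w * b) q + averaged W (\<lambda>w. x w * b) ?V q) q"
    using W(2) V by (intro averaged_cong) auto
  also have "\<dots> = averaged W (\<lambda>w. x w * a) (gain W (\<lambda>w. x w * b)) q +
    averaged W (\<lambda>w. x w * a) (averaged W (\<lambda>w. x w * b) ?V) q"
    unfolding averaged_def[of W "\<lambda>w. x w * a"]
    by (intro nn_integral_add meas functional_gain functional_averaged functional_uncertainty)
  also have "averaged W (\<lambda>w. x w * a) (averaged W (\<lambda>w. x w * b) ?V) q = averaged W (\<lambda>w. x w * of_real ?s) ?V q"
    using W by (intro averaged_rotate functional_uncertainty)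
  finally have split: "averaged W (\<lambda>w. x w * a) ?V q = averaged W (\<lambda>w. x w * a) (gain W (\<lambda>w. x w * b)) q + ?C" .
  have "?C \<le> ?V q"
    unfolding V[OF W(2), of "\<lambda>w. x w * of_real ?s"] by simp
  then have top: "?C < \<infinity>" by (rule le_less_trans) simp
  have 1: "?C + (averaged W (\<lambda>w. x w * a) (gain W (\<lambda>w. x w * b)) q + gain W (\<lambda>w. x w * a) q) = ?V q"
    unfolding V[OF W(2), of "\<lambda>w. x w * a"] split by (simp only: ac_simps)
  have 2: "?C + gain W (\<lambda>w. x w * of_real ?s) q = ?V q"
    unfolding V[OF W(2), of "\<lambda>w. x w * of_real ?s"] by (rule add.commute)
  show ?thesis
    using trans[OF 1 2[symmetric]] top unfolding ennreal_add_left_cancel by auto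
qed

lemma gain_finite:
  assumes "finite W" "weight W q"
  shows "gain W f q < \<infinity>"
proof -
  have "gain W f q \<le> ennreal (uncertainty W (\<lambda>w. w) q)"
    using uncertainty_split[OF assms, of "\<lambda>w. w" f] by simp
  then show ?thesis by (rule le_less_trans) simp
qed

subsection \<open>Independent coordinates\<close>

lemma gain_reindex:
  assumes W: "finite W" and h: "inj_on h U" "h ` U \<subseteq> W"
    and 0: "\<And>w. w \<in> W - h ` U \<Longrightarrow> q w = 0"
  shows "gain W f q = gain U (\<lambda>u. f (h u)) (\<lambda>u. q (h u))"
proof -
  have *: "(\<Sum>w\<in>W. q w * F w) = (\<Sum>u\<in>U. q (h u) * F (h u))" for F
  proof -
    have "(\<Sum>w\<in>W. q w * F w) = (\<Sum>w\<in>h ` U. q w * F w)"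
      using W h 0 by (intro sum.mono_neutral_right) auto
    then show ?thesis using h(1) by (simp add: sum.reindex)
  qed
  have "sum q W = (\<Sum>u\<in>U. q (h u))" using *[of "\<lambda>_. 1"] by simp
  then have "gain_density W f q y = gain_density U (\<lambda>u. f (h u)) (\<lambda>u. q (h u)) y" for y
    unfolding gain_density_def mixture_def * by simp
  then show ?thesis by (simp add: gain_def)
qed

lemma gain_zero: "(\<And>w. w \<in> W \<Longrightarrow> q w = 0) \<Longrightarrow> gain W f q = 0"
  by (simp add: gain_def gain_density_def)

definition configs :: "'u set \<Rightarrow> nat \<Rightarrow> (nat \<Rightarrow> 'u) set" where
  "configs U n = PiE {..<n} (\<lambda>_. U)"

definition prob_config :: "('u \<Rightarrow> real) \<Rightarrow> nat \<Rightarrow> (nat \<Rightarrow> 'u) \<Rightarrow> real" where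
  "prob_config p n w = (\<Prod>j<n. p (w j))"

text \<open>The law of a configuration whose coordinate \<open>l\<close> is resampled and whose other coordinates are
  those of \<open>v\<close>.\<close>

definition resampled :: "('u \<Rightarrow> real) \<Rightarrow> nat \<Rightarrow> (nat \<Rightarrow> 'u) \<Rightarrow> (nat \<Rightarrow> 'u) \<Rightarrow> real" where
  "resampled p l v w = (if w(l := v l) = v then p (w l) else 0)"

context
  fixes U :: "'u set" and p :: "'u \<Rightarrow> real"
  assumes U: "finite U" and p: "\<forall>u\<in>U. 0 \<le> p u" and sum_p: "sum p U = 1"
begin

lemma finite_configs: "finite (configs U n)"
  using U by (auto simp: configs_def intro: finite_PiE)

lemma weight_prob_config: "weight (configs U n) (prob_config p n)"
  using p by (auto simp: weight_def prob_config_def configs_def intro!: prod_nonneg)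

lemma sum_prob_config: "(\<Sum>w\<in>configs U n. prob_config p n w) = 1"
  unfolding prob_config_def configs_def
  using prod_sum_PiE[of "{..<n}" "\<lambda>_. U" "\<lambda>_. p"] U sum_p by simp

lemma config_update: "w \<in> configs U n \<Longrightarrow> l < n \<Longrightarrow> u \<in> U \<Longrightarrow> w(l := u) \<in> configs U n"
  by (auto simp: configs_def PiE_iff extensional_def)

lemma prob_config_update:
  assumes "l < n"
  shows "prob_config p n (w(l := u)) * p (w l) = p u * prob_config p n w"
proof -
  have "prob_config p n w = p (w l) * (\<Prod>j\<in>{..<n} - {l}. p (w j))" for w
    unfolding prob_config_def using assms by (intro prod.remove) auto
  moreover have "(\<Prod>j\<in>{..<n} - {l}. p ((w(l := u)) j)) = (\<Prod>j\<in>{..<n} - {l}. p (w j))"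
    by (intro prod.cong) auto
  ultimately show ?thesis by (simp add: fun_upd_same[of w l u])
qed

lemma weight_resampled: "l < n \<Longrightarrow> weight (configs U n) (resampled p l v)"
  using p by (auto simp: weight_def resampled_def configs_def)

text \<open>Replacing one coordinate of an independent family by a fresh copy does not change the
  law. The \<open>v\<close> that contribute to \<open>w\<close> are the configurations
  \<open>w(l := u)\<close>, and summation over \<open>u\<close> removes the old coordinate.\<close>

lemma sum_resampled:
  assumes l: "l < n" and w: "w \<in> configs U n"
  shows "(\<Sum>v\<in>configs U n. prob_config p n v * resampled p l v w) = prob_config p n w"
proof -
  have inj: "inj_on (\<lambda>u. w(l := u)) U" by (auto simp: inj_on_def fun_upd_eqD)
  have "v \<in> (\<lambda>u. w(l := u)) ` U" if "v \<in> configs U n" "w(l := v l) = v" for v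
  proof
    show "v = w(l := v l)" using that by simp
  qed (use that l in \<open>auto simp: configs_def\<close>)
  then have "(\<Sum>v\<in>configs U n. prob_config p n v * resampled p l v w) =
    (\<Sum>v\<in>(\<lambda>u. w(l := u)) ` U. prob_config p n v * resampled p l v w)"
    using config_update[OF w l] finite_configs
    by (intro sum.mono_neutral_right) (auto simp: resampled_def)
  also have "\<dots> = (\<Sum>u\<in>U. prob_config p n (w(l := u)) * p (w l))"
    using inj by (simp add: sum.reindex resampled_def)
  also have "\<dots> = prob_config p n w"
    using l sum_p by (simp add: prob_config_update sum_distrib_right[symmetric])
  finally show ?thesis .
qed

text \<open>The resampled law is the image of \<open>p\<close> under
  \<open>u \<mapsto> v(l := u)\<close>, so the gain is that of a single coordinate. Homogeneity
  covers only positive factors, whence the case distinction.\<close>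

lemma gain_resampled:
  assumes l: "l < n" and v: "v \<in> configs U n"
  shows "gain (configs U n) (\<lambda>w. f (w l)) (\<lambda>w. prob_config p n v * resampled p l v w) =
    ennreal (prob_config p n v) * gain U f p"
proof (cases "prob_config p n v = 0")
  case True
  then show ?thesis by (simp add: gain_zero)
next
  case False
  then have "0 < prob_config p n v"
    using weightD[OF weight_prob_config v] by simp
  then have "gain (configs U n) (\<lambda>w. f (w l)) (\<lambda>w. prob_config p n v * resampled p l v w) =
    ennreal (prob_config p n v) * gain (configs U n) (\<lambda>w. f (w l)) (resampled p l v)"
    by (rule functionalD(3)[OF functional_gain]) (rule weight_resampled[OF l])
  also have "gain (configs U n) (\<lambda>w. f (w l)) (resampled p l v) =
    gain U (\<lambda>u. f ((v(l := u)) l)) (\<lambda>u. resampled p l v (v(l := u)))"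
  proof (rule gain_reindex[OF finite_configs])
    show "inj_on (\<lambda>u. v(l := u)) U" by (auto simp: inj_on_def fun_upd_eqD)
    show "(\<lambda>u. v(l := u)) ` U \<subseteq> configs U n" using config_update[OF v l] by auto
    fix w assume w: "w \<in> configs U n - (\<lambda>u. v(l := u)) ` U"
    have "w \<in> (\<lambda>u. v(l := u)) ` U" if "w(l := v l) = v"
    proof
      show "w = v(l := w l)" using that by (metis fun_upd_triv fun_upd_upd)
    qed (use w l in \<open>auto simp: configs_def\<close>)
    then show "resampled p l v w = 0" using w by (auto simp: resampled_def)
  qed
  finally show ?thesis by (simp add: resampled_def)
qed

end

section \<open>Lower bound for each gain in the chain rule\<close>

context
  fixes U :: "complex set" and p :: "complex \<Rightarrow> real"
  assumes U: "finite U" and p: "\<forall>u\<in>U. 0 \<le> p u" and sum_p: "sum p U = 1"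
begin

text \<open>The product law is split into the parts \<open>q v\<close>, on which all coordinates but
  \<open>l\<close> are known; superadditivity says that this only lowers the gain, and each part is
  a problem about one coordinate. The additive form avoids truncated subtraction of extended
  nonnegative reals.\<close>

lemma gain_step:
  fixes \<beta> :: "int \<Rightarrow> complex" and n l :: nat and t s :: real
  assumes l: "l < n" and t: "0 \<le> t" "(\<Sum>k<l. (cmod (\<beta> (int k)))\<^sup>2) \<le> t\<^sup>2"
    and s: "0 \<le> s" "s\<^sup>2 = t\<^sup>2 + (cmod (\<beta> (- 1)))\<^sup>2"
  defines "fs \<equiv> map (\<lambda>i w. \<Sum>j<n. w j * \<beta> (int j - int i - 1)) [0..<n]"
  shows "gain U (\<lambda>u. u * of_real s) p \<le>
    observed (configs U n) (take l fs) (gain (configs U n) (fs ! l)) (prob_config p n) +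
    gain U (\<lambda>u. u * of_real t) p"
proof -
  let ?W = "configs U n" and ?P = "prob_config p n"
  let ?F = "observed ?W (take l fs) (gain ?W (fs ! l))"
  let ?f = "\<lambda>c w. w l * c :: complex"
  have W: "finite ?W" by (rule finite_configs[OF U p sum_p])
  define q where "q v = (\<lambda>w. ?P v * resampled p l v w)" for v
  have q: "weight ?W (q v)" if "v \<in> ?W" for v
    using weightD[OF weight_prob_config[OF U p sum_p] that] weight_resampled[OF U p sum_p l, of v]
    by (auto simp: weight_def q_def)
  have F: "functional ?W ?F" by (intro functional_observed functional_gain)
  have q_gain: "gain ?W (?f c) (q v) = ennreal (?P v) * gain U (\<lambda>u. u * c) p" if "v \<in> ?W" for v c
    using gain_resampled[OF U p sum_p l that, of "\<lambda>u. u * c"] by (simp add: q_def)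
  have P1: "(\<Sum>v\<in>?W. ennreal (?P v)) = 1"
    using weightD[OF weight_prob_config[OF U p sum_p]] sum_prob_config[OF U p sum_p]
    by (subst sum_ennreal) auto
  \<comment> \<open>For the earlier observations \<open>i < l\<close> the index
    \<open>l - i - 1\<close> runs through \<open>l - 1, \<dots>, 0\<close>; the current one,
    \<open>i = l\<close>, has index \<open>- 1\<close>.\<close>
  define bs where "bs = map (\<lambda>i. \<beta> (int l - int i - 1)) [0..<l]"
  have bs: "(\<Sum>b\<leftarrow>bs. (cmod b)\<^sup>2) \<le> t\<^sup>2"
  proof -
    have "(\<Sum>b\<leftarrow>bs. (cmod b)\<^sup>2) = (\<Sum>i<l. (cmod (\<beta> (int l - int i - 1)))\<^sup>2)"
      by (simp add: bs_def comp_def interv_sum_list_conv_sum_set_nat atLeast0LessThan)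
    also have "\<dots> = (\<Sum>i<l. (cmod (\<beta> (int (l - Suc i))))\<^sup>2)"
      by (intro sum.cong refl) (simp add: of_nat_diff algebra_simps)
    also have "\<dots> = (\<Sum>k<l. (cmod (\<beta> (int k)))\<^sup>2)"
      by (rule sum.nat_diff_reindex)
    finally show ?thesis using t by simp
  qed
  \<comment> \<open>On the support of \<open>q v\<close> the coordinates other than \<open>l\<close>
    are those of \<open>v\<close>, so their contribution is a constant offset.\<close>
  have line: "(fs ! i) w = w l * \<beta> (int l - int i - 1) + (\<Sum>j\<in>{..<n} - {l}. v j * \<beta> (int j - int i - 1))"
    if "i < n" "q v w \<noteq> 0" for i v w
  proof -
    have "w(l := v l) = v" using that by (auto simp: q_def resampled_def split: if_splits)
    then have wv: "w j = v j" if "j \<noteq> l" for j using that by (metis fun_upd_other)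
    have "(fs ! i) w = (\<Sum>j<n. w j * \<beta> (int j - int i - 1))" using that by (simp add: fs_def)
    also have "\<dots> = w l * \<beta> (int l - int i - 1) + (\<Sum>j\<in>{..<n} - {l}. w j * \<beta> (int j - int i - 1))"
      using l by (intro sum.remove) auto
    finally show ?thesis using wv by simp
  qed
  have "averaged ?W (?f (of_real t)) (gain ?W (?f (\<beta> (- 1)))) (q v) \<le> ?F (q v)" if v: "v \<in> ?W" for v
  proof -
    have "?F (q v) = observed ?W (map ?f bs) (gain ?W (?f (\<beta> (- 1)))) (q v)"
    proof (rule observed_affine[OF functional_gain functional_gain q[OF v],
          where c = "\<lambda>i. \<Sum>j\<in>{..<n} - {l}. v j * \<beta> (int j - int i - 1)"])
      show "length bs = length (take l fs)" using l by (simp add: bs_def fs_def)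
      fix i w assume "i < length (take l fs)" "q v w \<noteq> 0"
      then show "(take l fs ! i) w = w l * bs ! i + (\<Sum>j\<in>{..<n} - {l}. v j * \<beta> (int j - int i - 1))"
        using line[of i v w] l by (simp add: bs_def fs_def)
    next
      fix q' :: "(nat \<Rightarrow> complex) \<Rightarrow> real" assume "\<And>w. w \<in> ?W \<Longrightarrow> q v w = 0 \<Longrightarrow> q' w = 0"
      then show "gain ?W (fs ! l) q' = gain ?W (?f (\<beta> (- 1))) q'"
        using line[OF l, of v] by (intro gain_affine) auto
    qed
    then show ?thesis using averaged_gain_le_observed[OF W q[OF v] bs t(1)] by simp
  qed
  then have "(\<Sum>v\<in>?W. averaged ?W (?f (of_real t)) (gain ?W (?f (\<beta> (- 1)))) (q v)) \<le> (\<Sum>v\<in>?W. ?F (q v))"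
    by (rule sum_mono)
  also have "\<dots> \<le> ?F (\<lambda>w. \<Sum>v\<in>?W. q v w)"
    by (rule observed_gain_superadditive[OF W W q])
  also have "\<dots> = ?F ?P"
    using sum_resampled[OF U p sum_p l] by (intro functional_cong[OF F]) (simp add: q_def)
  finally have *: "(\<Sum>v\<in>?W. averaged ?W (?f (of_real t)) (gain ?W (?f (\<beta> (- 1)))) (q v)) \<le> ?F ?P" .
  \<comment> \<open>Strength \<open>t\<close> followed by coefficient \<open>\<beta> (- 1)\<close>
    amounts to strength \<open>s\<close>; this expresses the gain in \<open>*\<close> through the
    gains at \<open>s\<close> and \<open>t\<close>.\<close>
  have "sqrt (t\<^sup>2 + (cmod (\<beta> (- 1)))\<^sup>2) = s" using s by (metis real_sqrt_unique)
  then have chain: "gain ?W (?f (of_real s)) (q v) =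
      averaged ?W (?f (of_real t)) (gain ?W (?f (\<beta> (- 1)))) (q v) + gain ?W (?f (of_real t)) (q v)"
    if "v \<in> ?W" for v
    using averaged_gain_chain[OF W q[OF that], of "\<lambda>w. w l" "of_real t" "\<beta> (- 1)"] by simp
  have "gain U (\<lambda>u. u * of_real s) p = (\<Sum>v\<in>?W. gain ?W (?f (of_real s)) (q v))"
    using P1 by (simp add: q_gain sum_distrib_right[symmetric])
  also have "\<dots> = (\<Sum>v\<in>?W. averaged ?W (?f (of_real t)) (gain ?W (?f (\<beta> (- 1)))) (q v)) +
      (\<Sum>v\<in>?W. ennreal (?P v) * gain U (\<lambda>u. u * of_real t) p)"
    by (simp add: chain q_gain sum.distrib)
  also have "(\<Sum>v\<in>?W. ennreal (?P v) * gain U (\<lambda>u. u * of_real t) p) = gain U (\<lambda>u. u * of_real t) p"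
    using P1 by (simp add: sum_distrib_right[symmetric])
  finally show ?thesis using add_right_mono[OF *] by simp
qed

text \<open>\<open>gain_step\<close> is summed over all \<open>l < n\<close> and compared with the
  chain rule; the assumption on \<open>Z\<close> says that every observation is a function of
  \<open>Z\<close>. Gains are finite, so the difference may be formed in the reals at the
  end.\<close>

lemma gain_le_uncertainty:
  fixes \<beta> :: "int \<Rightarrow> complex" and n :: nat and t s :: real
  assumes t: "0 \<le> t" "\<And>l. (\<Sum>k<l. (cmod (\<beta> (int k)))\<^sup>2) \<le> t\<^sup>2"
    and s: "0 \<le> s" "s\<^sup>2 = t\<^sup>2 + (cmod (\<beta> (- 1)))\<^sup>2"
    and Z: "\<And>v w i. v \<in> configs U n \<Longrightarrow> w \<in> configs U n \<Longrightarrow> i < n \<Longrightarrow> Z v = Z w \<Longrightarrow>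
      (\<Sum>j<n. v j * \<beta> (int j - int i - 1)) = (\<Sum>j<n. w j * \<beta> (int j - int i - 1))"
  shows "real n * (enn2real (gain U (\<lambda>u. u * of_real s) p) - enn2real (gain U (\<lambda>u. u * of_real t) p)) \<le>
    uncertainty (configs U n) Z (prob_config p n)"
proof -
  let ?W = "configs U n" and ?P = "prob_config p n" and ?g = "\<lambda>s. gain U (\<lambda>u. u * of_real s) p"
  define fs where "fs = map (\<lambda>i w. \<Sum>j<n. w j * \<beta> (int j - int i - 1)) [0..<n]"
  have W: "finite ?W" "weight ?W ?P" 
    using finite_configs[OF U p sum_p] weight_prob_config[OF U p sum_p] by auto
  have fin: "?g r < \<infinity>" for r using U p by (intro gain_finite) (auto simp: weight_def)
  have "(\<Sum>l<n. ?g s) \<le> (\<Sum>l<n. observed ?W (take l fs) (gain ?W (fs ! l)) ?P + ?g t)"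
    unfolding fs_def by (intro sum_mono gain_step t s) auto
  also have "\<dots> = (\<Sum>l<length fs. observed ?W (take l fs) (gain ?W (fs ! l)) ?P) + of_nat n * ?g t"
    by (simp add: sum.distrib fs_def)
  also have "\<dots> \<le> ennreal (uncertainty ?W Z ?P) + of_nat n * ?g t"
  proof (intro add_right_mono sum_gain_le_uncertainty W)
    fix f w v assume f: "f \<in> set fs" and wv: "w \<in> ?W" "v \<in> ?W" "Z w = Z v"
    from f obtain i where i: "i < n" "f = (\<lambda>w. \<Sum>j<n. w j * \<beta> (int j - int i - 1))"
      by (auto simp: fs_def)
    show "f w = f v" unfolding i(2) by (rule Z[OF wv(1,2) i(1) wv(3)])
  qed
  finally have main: "of_nat n * ?g s \<le> ennreal (uncertainty ?W Z ?P) + of_nat n * ?g t" by simp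
  define G where "G r = enn2real (?g r)" for r :: real
  have G: "0 \<le> G r" for r by (simp add: G_def)
  have g: "of_nat n * ?g r = ennreal (n * G r)" for r
  proof -
    have "?g r = ennreal (G r)" using fin[of r] by (simp add: G_def ennreal_enn2real infinity_ennreal_def)
    then show ?thesis using G by (simp add: ennreal_of_nat_eq_real_of_nat ennreal_mult)
  qed
  have "ennreal (n * G s) \<le> ennreal (uncertainty ?W Z ?P + n * G t)"
    using main uncertainty_nonneg[OF W, of Z] G[of t] unfolding g by (subst ennreal_plus) auto
  then have "n * G s \<le> uncertainty ?W Z ?P + n * G t"
    using uncertainty_nonneg[OF W, of Z] G[of t] by (subst (asm) ennreal_le_iff) auto
  then show ?thesis by (simp add: G_def right_diff_distrib)
qed

end

subsection \<open>Differential and Shannon entropy of finitely supported laws\<close>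

lemma complex_gaussian_eq: "complex_gaussian = density lborel (\<lambda>z. ennreal (gauss z))"
  by (simp add: complex_gaussian_def gauss_def)

lemma prob_space_complex_gaussian: "prob_space complex_gaussian"
  by (rule prob_spaceI) (simp add: complex_gaussian_eq emeasure_density nn_integral_gauss)

text \<open>Up to a factor this is a Gaussian density with variance 2 in each coordinate; it serves
  as integrable bound for \<open>(cmod z)\<^sup>2 * gauss z\<close>.\<close>

lemma integrable_exp_neg_square: "integrable lborel (\<lambda>z::complex. exp (- (cmod z)\<^sup>2 / 4))"
proof -
  have 1: "(\<integral>\<^sup>+x. ennreal (normal_density 0 (sqrt 2) x) \<partial>lborel) = 1"
    using prob_space.emeasure_space_1[OF prob_space_normal_density[of "sqrt 2" 0]]
    by (simp add: emeasure_density)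
  have "exp (- (cmod z)\<^sup>2 / 4) = 4 * pi * (normal_density 0 (sqrt 2) (Re z) * normal_density 0 (sqrt 2) (Im z))" for z
    by (simp add: normal_density_def cmod_power2 exp_add[symmetric] add_divide_distrib)
  then have "ennreal (exp (- (cmod z)\<^sup>2 / 4)) = ennreal (4 * pi) * (\<Prod>b\<in>Basis. ennreal (normal_density 0 (sqrt 2) (z \<bullet> b)))" for z
    by (simp add: Basis_complex_def ennreal_mult complex_eq_iff)
  moreover have "(\<integral>\<^sup>+(z::complex). (\<Prod>b\<in>Basis. ennreal (normal_density 0 (sqrt 2) (z \<bullet> b))) \<partial>lborel) = 1"
    by (subst nn_integral_lborel_prod[where f = "\<lambda>_ x. ennreal (normal_density 0 (sqrt 2) x)"]) (simp_all add: 1)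
  ultimately have "(\<integral>\<^sup>+(z::complex). ennreal (exp (- (cmod z)\<^sup>2 / 4)) \<partial>lborel) = ennreal (4 * pi)"
    by (simp add: nn_integral_cmult)
  then show ?thesis by (intro integrableI_nonneg) auto
qed

lemma integrable_gauss_ln: "integrable lborel (\<lambda>z. gauss z * ln (gauss z))"
proof -
  have g: "integrable lborel gauss"
    using has_bochner_integral_gauss[of 0] by (simp add: has_bochner_integral_iff)
  have "integrable lborel (\<lambda>z. (cmod z)\<^sup>2 * gauss z)"
  proof (rule Bochner_Integration.integrable_bound)
    show "integrable lborel (\<lambda>z::complex. 4 * exp (- (cmod z)\<^sup>2 / 4))"
      using integrable_exp_neg_square by simp
    show "AE z in lborel. norm ((cmod z)\<^sup>2 * gauss z) \<le> norm (4 * exp (- (cmod z)\<^sup>2 / 4))"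
    proof (rule AE_I2)
      fix z :: complex
      have "(cmod z)\<^sup>2 / 4 \<le> exp ((cmod z)\<^sup>2 / 4)"
        using exp_ge_add_one_self[of "(cmod z)\<^sup>2 / 4"] by linarith
      then have "(cmod z)\<^sup>2 / 4 * exp (- (cmod z)\<^sup>2 / 2) \<le> exp ((cmod z)\<^sup>2 / 4) * exp (- (cmod z)\<^sup>2 / 2)"
        by (intro mult_right_mono) auto
      also have "\<dots> = exp (- (cmod z)\<^sup>2 / 4)" by (simp add: exp_add[symmetric])
      finally have "(cmod z)\<^sup>2 * exp (- (cmod z)\<^sup>2 / 2) \<le> 4 * exp (- (cmod z)\<^sup>2 / 4)" by simp
      moreover have "(cmod z)\<^sup>2 * gauss z \<le> (cmod z)\<^sup>2 * exp (- (cmod z)\<^sup>2 / 2)"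
      proof (rule mult_left_mono)
        have "1 \<le> 2 * pi" using pi_gt3 by simp
        then show "gauss z \<le> exp (- (cmod z)\<^sup>2 / 2)"
          unfolding gauss_def by (simp add: divide_le_eq_1 field_simps)
      qed simp
      ultimately show "norm ((cmod z)\<^sup>2 * gauss z) \<le> norm (4 * exp (- (cmod z)\<^sup>2 / 4))"
        by (simp add: abs_mult)
    qed
  qed simp
  then have "integrable lborel (\<lambda>z. - (1 / 2) * ((cmod z)\<^sup>2 * gauss z) - ln (2 * pi) * gauss z)"
    using g by simp
  also have "(\<lambda>z. - (1 / 2) * ((cmod z)\<^sup>2 * gauss z) - ln (2 * pi) * gauss z) = (\<lambda>z. gauss z * ln (gauss z))"
  proof
    fix z
    have ln: "ln (gauss z) = - (cmod z)\<^sup>2 / 2 - ln (2 * pi)"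
      unfolding gauss_def by (subst ln_div) auto
    show "- (1 / 2) * ((cmod z)\<^sup>2 * gauss z) - ln (2 * pi) * gauss z = gauss z * ln (gauss z)"
      unfolding ln by (simp add: algebra_simps)
  qed
  finally show ?thesis .
qed

lemma has_bochner_integral_shift:
  fixes f :: "complex \<Rightarrow> real"
  assumes f: "integrable lborel f"
  shows "has_bochner_integral lborel (\<lambda>z. f (z - c)) (integral\<^sup>L lborel f)"
proof -
  have [measurable]: "f \<in> borel_measurable borel" using f by auto
  have d: "distr lborel borel ((+) (- c)) = lborel" by (rule lborel_distr_plus)
  have "integrable (distr lborel borel ((+) (- c))) f" "integral\<^sup>L (distr lborel borel ((+) (- c))) f = integral\<^sup>L lborel f"
    unfolding d using f by auto
  then show ?thesis
    by (subst (asm) integrable_distr_eq, simp, simp, subst (asm) integral_distr) (auto simp: has_bochner_integral_iff)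
qed

text \<open>\<open>U\<close> is any finite set of full mass and may contain null points, as happens
  for \<open>atomic_law\<close> when some \<open>p j\<close> is 0.\<close>

locale finite_law = prob_space \<nu> for \<nu> :: "complex measure" +
  fixes U :: "complex set"
  assumes sets_\<nu> [simp, measurable_cong]: "sets \<nu> = sets borel" and finite_U: "finite U"
    and measure_U: "measure \<nu> U = 1"
begin

abbreviation atom :: "complex \<Rightarrow> real" where
  "atom u \<equiv> measure \<nu> {u}"

lemma space_\<nu> [simp]: "space \<nu> = UNIV"
  using sets_eq_imp_space_eq[OF sets_\<nu>] by simp

lemma finite_sets [simp]: "finite A \<Longrightarrow> A \<in> sets \<nu>"
  by (metis borel_closed finite_imp_closed sets_\<nu>)

lemma AE_U: "AE u in \<nu>. u \<in> U"
  using measure_U finite_U AE_prob_1[of U] by simp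

lemma sum_atom: "sum atom U = 1"
  using finite_measure_eq_sum_singleton[of U] measure_U finite_U by simp

lemma nn_integral_law: "(\<integral>\<^sup>+u. f u \<partial>\<nu>) = (\<Sum>u\<in>U. f u * ennreal (atom u))"
proof -
  have "(\<integral>\<^sup>+u. f u \<partial>\<nu>) = (\<integral>\<^sup>+u. f u * indicator U u \<partial>\<nu>)"
    using AE_U by (intro nn_integral_cong_AE) auto
  also have "\<dots> = (\<Sum>u\<in>U. f u * emeasure \<nu> {u})"
    by (rule nn_integral_indicator_finite) (auto simp: finite_U)
  finally show ?thesis by (simp add: emeasure_eq_measure)
qed

lemma weight_atom: "weight U atom"
  by (simp add: weight_def)

lemma distributed_smoothed:
  "distributed (\<nu> \<Otimes>\<^sub>M complex_gaussian) lborel (\<lambda>(\<xi>, G). of_real s * \<xi> + G)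
     (\<lambda>y. ennreal (mixture U (\<lambda>u. u * of_real s) atom y))"
  unfolding distributed_def
proof (intro conjI)
  interpret G: prob_space complex_gaussian by (rule prob_space_complex_gaussian)
  have sets_G [measurable_cong]: "sets complex_gaussian = sets borel" by (simp add: complex_gaussian_eq)
  show X: "(\<lambda>(\<xi>, G). of_real s * \<xi> + G) \<in> \<nu> \<Otimes>\<^sub>M complex_gaussian \<rightarrow>\<^sub>M lborel"
    by measurable
  show "(\<lambda>y. ennreal (mixture U (\<lambda>u. u * of_real s) atom y)) \<in> borel_measurable lborel"
    unfolding mixture_def by measurable
  show "distr (\<nu> \<Otimes>\<^sub>M complex_gaussian) lborel (\<lambda>(\<xi>, G). of_real s * \<xi> + G) =
    density lborel (\<lambda>y. ennreal (mixture U (\<lambda>u. u * of_real s) atom y))"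
  proof (rule measure_eqI)
    fix A assume "A \<in> sets (distr (\<nu> \<Otimes>\<^sub>M complex_gaussian) lborel (\<lambda>(\<xi>, G). of_real s * \<xi> + G))"
    then have A [measurable]: "A \<in> sets borel" by simp
    let ?X = "(\<lambda>(\<xi>, G). of_real s * \<xi> + G) -` A \<inter> space (\<nu> \<Otimes>\<^sub>M complex_gaussian) :: (complex \<times> complex) set"
    have XA: "?X \<in> sets (\<nu> \<Otimes>\<^sub>M complex_gaussian)"
      using X A by (rule measurable_sets[of _ _ lborel, simplified sets_lborel])
    have slice: "emeasure complex_gaussian (Pair u -` ?X) =
      (\<integral>\<^sup>+y. ennreal (gauss (y - u * of_real s)) * indicator A y \<partial>lborel)" for u
    proof -
      have "Pair u -` ?X = (\<lambda>g. g + u * of_real s) -` A"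
        by (auto simp: space_pair_measure complex_gaussian_eq ac_simps)
      moreover have "(\<lambda>g. g + u * of_real s) -` A \<in> sets borel"
        using measurable_sets[of "\<lambda>g. g + u * of_real s" borel borel A] by simp
      ultimately have "emeasure complex_gaussian (Pair u -` ?X) =
        (\<integral>\<^sup>+g. ennreal (gauss (g + u * of_real s - u * of_real s)) * indicator A (g + u * of_real s) \<partial>lborel)"
        by (auto simp: complex_gaussian_eq emeasure_density indicator_def intro!: nn_integral_cong)
      also have "\<dots> = (\<integral>\<^sup>+y. ennreal (gauss (y - u * of_real s)) * indicator A y \<partial>lborel)"
        by (rule nn_integral_lborel_shift) measurable
      finally show ?thesis .
    qed
    have "emeasure (distr (\<nu> \<Otimes>\<^sub>M complex_gaussian) lborel (\<lambda>(\<xi>, G). of_real s * \<xi> + G)) A =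
      emeasure (\<nu> \<Otimes>\<^sub>M complex_gaussian) ?X"
      using X by (rule emeasure_distr) simp
    also have "\<dots> = (\<integral>\<^sup>+u. emeasure complex_gaussian (Pair u -` ?X) \<partial>\<nu>)"
      by (rule G.emeasure_pair_measure_alt[OF XA])
    also have "\<dots> = (\<Sum>u\<in>U. \<integral>\<^sup>+y. ennreal (atom u * gauss (y - u * of_real s)) * indicator A y \<partial>lborel)"
      unfolding nn_integral_law slice
      by (intro sum.cong refl, subst nn_integral_multc[symmetric]) (auto simp: ennreal_mult mult_ac)
    also have "\<dots> = (\<integral>\<^sup>+y. (\<Sum>u\<in>U. ennreal (atom u * gauss (y - u * of_real s)) * indicator A y) \<partial>lborel)"
      by (rule nn_integral_sum[symmetric]) measurable
    also have "\<dots> = (\<integral>\<^sup>+y. ennreal (mixture U (\<lambda>u. u * of_real s) atom y) * indicator A y \<partial>lborel)"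
      by (simp add: mixture_def sum_distrib_right[symmetric] sum_ennreal)
    also have "\<dots> = emeasure (density lborel (\<lambda>y. ennreal (mixture U (\<lambda>u. u * of_real s) atom y))) A"
      unfolding mixture_def by (subst emeasure_density) auto
    finally show "emeasure (distr (\<nu> \<Otimes>\<^sub>M complex_gaussian) lborel (\<lambda>(\<xi>, G). of_real s * \<xi> + G)) A =
      emeasure (density lborel (\<lambda>y. ennreal (mixture U (\<lambda>u. u * of_real s) atom y))) A" .
  qed simp
qed

text \<open>Differential entropy of signal plus noise is mutual information plus entropy of the
  noise. The noise term does not depend on \<open>s\<close>, so differences of smoothed entropies
  are differences of gains.\<close>

lemma smoothed_entropy_eq:
  "smoothed_entropy \<nu> s =
     enn2real (gain U (\<lambda>u. u * of_real s) atom) - (\<integral>z. gauss z * ln (gauss z) \<partial>lborel)"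
proof -
  interpret G: prob_space complex_gaussian by (rule prob_space_complex_gaussian)
  interpret pair_prob_space \<nu> complex_gaussian ..
  interpret information_space "\<nu> \<Otimes>\<^sub>M complex_gaussian" "exp 1" by unfold_locales simp
  let ?f = "\<lambda>u. u * complex_of_real s"
  define m where "m = mixture U ?f atom"
  define D where "D = gain_density U ?f atom"
  define L where "L y = (\<Sum>u\<in>U. atom u * (gauss (y - ?f u) * ln (gauss (y - ?f u))))" for y
  let ?h = "\<integral>z. gauss z * ln (gauss z) \<partial>lborel"
  have W: "finite U" "weight U atom" by (rule finite_U weight_atom)+
  have m: "0 < m y" for y unfolding m_def using W by (rule mixture_pos) (simp add: sum_atom)
  have D0: "0 \<le> D y" for y unfolding D_def by (rule gain_density_nonneg[OF W])
  have [measurable]: "D \<in> borel_measurable borel" unfolding D_def by measurable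
  have fin: "(\<integral>\<^sup>+y. ennreal (D y) \<partial>lborel) < \<infinity>"
    using gain_finite[OF W] by (simp add: gain_def D_def)
  have D: "integrable lborel D"
    by (rule integrableI_nonneg) (use D0 fin in auto)
  have ID: "integral\<^sup>L lborel D = enn2real (gain U ?f atom)"
    using D0 by (subst integral_eq_nn_integral) (auto simp: gain_def D_def)
  have "has_bochner_integral lborel L (\<Sum>u\<in>U. atom u * ?h)"
    unfolding L_def
    using has_bochner_integral_shift[OF integrable_gauss_ln]
    by (intro has_bochner_integral_sum has_bochner_integral_mult_right) auto
  then have L: "has_bochner_integral lborel L ?h"
    by (simp add: sum_distrib_right[symmetric] sum_atom)
  \<comment> \<open>\<open>L\<close> is a mixture of translates of
    \<open>gauss z * ln (gauss z)\<close> with total weight 1, so its integral is that of the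
    unshifted function.\<close>
  have "m y * ln (m y) = L y - D y" for y
  proof -
    have "D y = (\<Sum>u\<in>U. atom u * (gauss (y - ?f u) * (ln (gauss (y - ?f u)) - ln (m y))))"
      unfolding D_def gain_density_def m_def[symmetric] using m[of y]
      by (simp add: sum_atom ln_div)
    also have "\<dots> = L y - m y * ln (m y)"
      by (simp add: L_def m_def mixture_def right_diff_distrib sum_subtractf sum_distrib_right mult.assoc)
    finally show ?thesis by simp
  qed
  then have "(\<integral>y. m y * ln (m y) \<partial>lborel) = ?h - integral\<^sup>L lborel D"
    using L D by (simp add: has_bochner_integral_iff)
  moreover have "smoothed_entropy \<nu> s = - (\<integral>y. m y * log (exp 1) (m y) \<partial>lborel)"
    unfolding smoothed_entropy_def
    using entropy_distr[OF distributed_smoothed] m by (simp add: m_def less_imp_le)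
  ultimately show ?thesis by (simp add: ID log_ln[symmetric])
qed

end

lemma uncertainty_eq_sum_image:
  assumes W: "finite W" "weight W q" and q: "sum q W = 1"
  shows "uncertainty W Z q =
    - (\<Sum>x\<in>Z ` W. sum q {v \<in> W. Z v = x} * ln (sum q {v \<in> W. Z v = x}))"
proof -
  have "uncertainty W Z q = (\<Sum>x\<in>Z ` W. \<Sum>w\<in>{v \<in> W. Z v = x}. q w * ln (1 / sum q {v \<in> W. Z v = Z w}))"
    unfolding uncertainty_def q by (rule sum.image_gen[OF W(1)])
  also have "\<dots> = (\<Sum>x\<in>Z ` W. - (sum q {v \<in> W. Z v = x} * ln (sum q {v \<in> W. Z v = x})))"
  proof (rule sum.cong[OF refl])
    fix x
    have "(\<Sum>w\<in>{v \<in> W. Z v = x}. q w * ln (1 / sum q {v \<in> W. Z v = Z w})) =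
      (\<Sum>w\<in>{v \<in> W. Z v = x}. q w * ln (1 / sum q {v \<in> W. Z v = x}))"
      by (rule sum.cong) auto
    also have "\<dots> = sum q {v \<in> W. Z v = x} * - ln (sum q {v \<in> W. Z v = x})"
    proof -
      have "0 \<le> sum q {v \<in> W. Z v = x}" using W by (auto simp: weight_def intro: sum_nonneg)
      then show ?thesis
        unfolding sum_distrib_right[symmetric] by (cases "sum q {v \<in> W. Z v = x} = 0") (simp_all add: ln_div)
    qed
    finally show "(\<Sum>w\<in>{v \<in> W. Z v = x}. q w * ln (1 / sum q {v \<in> W. Z v = Z w})) =
      - (sum q {v \<in> W. Z v = x} * ln (sum q {v \<in> W. Z v = x}))" by simp
  qed
  finally show ?thesis by (simp add: sum_negf)
qed

context finite_law
begin

interpretation P: product_prob_space "\<lambda>_::nat. \<nu>" UNIV ..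

lemma atom_nonneg: "\<forall>u\<in>U. 0 \<le> atom u"
  by simp

text \<open>Almost surely the first \<open>n\<close> coordinates lie in \<open>U\<close>, so up to a
  null set the event is a disjoint union of cylinders. Configurations are \<open>undefined\<close>
  from \<open>n\<close> on; \<open>dep\<close> lets \<open>f\<close> be evaluated at them
  nevertheless.\<close>

lemma measure_partial_sum:
  fixes f :: "(nat \<Rightarrow> complex) \<Rightarrow> complex"
  assumes f [measurable]: "f \<in> borel_measurable (PiM UNIV (\<lambda>_. \<nu>))"
    and dep: "\<And>v w. (\<And>j. j < n \<Longrightarrow> v j = w j) \<Longrightarrow> f v = f w"
  shows "measure (PiM UNIV (\<lambda>_. \<nu>)) {\<omega> \<in> space (PiM UNIV (\<lambda>_. \<nu>)). f \<omega> = x} =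
    sum (prob_config atom n) {c \<in> configs U n. f c = x}"
proof -
  let ?M = "PiM (UNIV :: nat set) (\<lambda>_. \<nu>)"
  define cyl where "cyl c = {\<omega> \<in> space ?M. \<forall>j\<in>{..<n}. \<omega> j \<in> {c j}}" for c
  have cyl_sets: "cyl c \<in> sets ?M" for c
    unfolding cyl_def by measurable
  have cyl: "measure ?M (cyl c) = prob_config atom n c" for c
    unfolding cyl_def measure_def
    by (subst P.emeasure_PiM_Collect) (auto simp: prob_config_def emeasure_eq_measure prod_ennreal prod_nonneg)
  let ?S = "{c \<in> configs U n. f c = x}"
  have fin: "finite ?S" using finite_configs[OF finite_U atom_nonneg sum_atom] by simp
  have AE: "AE \<omega> in ?M. \<forall>j\<in>{..<n}. \<omega> j \<in> U"
    using AE_U by (auto intro!: AE_finite_allI P.AE_component)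
  have "measure ?M {\<omega> \<in> space ?M. f \<omega> = x} = measure ?M (\<Union>c\<in>?S. cyl c)"
  proof (rule P.finite_measure_eq_AE)
    show "AE \<omega> in ?M. (\<omega> \<in> {\<omega> \<in> space ?M. f \<omega> = x}) = (\<omega> \<in> (\<Union>c\<in>?S. cyl c))"
      using AE
    proof eventually_elim
      case (elim \<omega>)
      show ?case
      proof
        assume \<omega>: "\<omega> \<in> {\<omega> \<in> space ?M. f \<omega> = x}"
        have "restrict \<omega> {..<n} \<in> ?S"
          using \<omega> elim dep[of "restrict \<omega> {..<n}" \<omega>] by (auto simp: configs_def)
        moreover have "\<omega> \<in> cyl (restrict \<omega> {..<n})" using \<omega> by (auto simp: cyl_def)
        ultimately show "\<omega> \<in> (\<Union>c\<in>?S. cyl c)" by blast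
      next
        assume "\<omega> \<in> (\<Union>c\<in>?S. cyl c)"
        then obtain c where c: "c \<in> ?S" "\<omega> \<in> cyl c" by blast
        then have "f \<omega> = f c" by (intro dep) (auto simp: cyl_def)
        then show "\<omega> \<in> {\<omega> \<in> space ?M. f \<omega> = x}" using c by (auto simp: cyl_def)
      qed
    qed
    show "(\<Union>c\<in>?S. cyl c) \<in> sets ?M" using fin cyl_sets by auto
  qed measurable
  also have "\<dots> = (\<Sum>c\<in>?S. measure ?M (cyl c))"
  proof (rule P.finite_measure_finite_Union[OF fin])
    show "disjoint_family_on cyl ?S"
      unfolding disjoint_family_on_def
    proof safe
      fix c d \<omega> assume "c \<in> configs U n" "d \<in> configs U n" "c \<noteq> d" "\<omega> \<in> cyl c" "\<omega> \<in> cyl d"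
      then show "\<omega> \<in> {}" by (auto simp: cyl_def configs_def PiE_eq_iff intro: PiE_ext)
    qed
  qed (use cyl_sets in auto)
  finally show ?thesis by (simp add: cyl)
qed

lemma shannon_entropy_partial_sum:
  "shannon_entropy (\<Pi>\<^sub>M j\<in>(UNIV :: nat set). \<nu>) (\<lambda>\<xi>. \<Sum>j<n. \<xi> j * \<eta> ^ j) =
     uncertainty (configs U n) (\<lambda>w. \<Sum>j<n. w j * \<eta> ^ j) (prob_config atom n)"
proof -
  let ?Z = "\<lambda>\<xi> :: nat \<Rightarrow> complex. \<Sum>j<n. \<xi> j * \<eta> ^ j" and ?W = "configs U n"
  define F where "F x = sum (prob_config atom n) {c \<in> ?W. ?Z c = x}" for x
  have W: "finite ?W" "weight ?W (prob_config atom n)" "sum (prob_config atom n) ?W = 1"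
    using finite_configs[OF finite_U atom_nonneg sum_atom] weight_prob_config[OF finite_U atom_nonneg sum_atom]
      sum_prob_config[OF finite_U atom_nonneg sum_atom] by auto
  have "measure (PiM UNIV (\<lambda>_. \<nu>)) {\<omega> \<in> space (PiM UNIV (\<lambda>_. \<nu>)). ?Z \<omega> = x} = F x" for x
    unfolding F_def by (rule measure_partial_sum) auto
  then have "shannon_entropy (\<Pi>\<^sub>M j\<in>(UNIV :: nat set). \<nu>) ?Z = - (\<Sum>\<^sub>\<infinity>x. F x * ln (F x))"
    by (simp add: shannon_entropy_def)
  \<comment> \<open>A value that no configuration attains has an empty fibre and contributes
    \<open>0 * ln 0 = 0\<close>.\<close>
  also have "(\<Sum>\<^sub>\<infinity>x. F x * ln (F x)) = (\<Sum>\<^sub>\<infinity>x\<in>?Z ` ?W. F x * ln (F x))"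
  proof (rule infsum_cong_neutral)
    fix x assume "x \<in> UNIV - ?Z ` ?W"
    then have empty: "{c \<in> ?W. ?Z c = x} = {}" by auto
    show "F x * ln (F x) = 0" unfolding F_def empty by simp
  qed auto
  also have "\<dots> = (\<Sum>x\<in>?Z ` ?W. F x * ln (F x))" using W(1) by simp
  finally show ?thesis using uncertainty_eq_sum_image[OF W, of ?Z] by (simp add: F_def)
qed

end

section \<open>Subadditivity of the entropy of partial sums\<close>

definition joined :: "nat \<Rightarrow> nat \<Rightarrow> (nat \<Rightarrow> 'u) \<Rightarrow> (nat \<Rightarrow> 'u) \<Rightarrow> nat \<Rightarrow> 'u" where
  "joined n m a b j = (if j < n then a j else if j < n + m then b (j - n) else undefined)"

lemma bij_betw_joined:
  "bij_betw (\<lambda>(a, b). joined n m a b) (configs U n \<times> configs U m) (configs U (n + m))"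
proof (rule bij_betw_byWitness[where f' = "\<lambda>w. (restrict w {..<n}, restrict (\<lambda>j. w (n + j)) {..<m})"])
  show "\<forall>x\<in>configs U n \<times> configs U m. (\<lambda>w. (restrict w {..<n}, restrict (\<lambda>j. w (n + j)) {..<m}))
      ((\<lambda>(a, b). joined n m a b) x) = x"
    by (auto simp: joined_def configs_def PiE_iff extensional_def restrict_def fun_eq_iff)
  show "\<forall>w\<in>configs U (n + m). (\<lambda>(a, b). joined n m a b) (restrict w {..<n}, restrict (\<lambda>j. w (n + j)) {..<m}) = w"
    by (auto simp: joined_def configs_def PiE_iff extensional_def fun_eq_iff)
  show "(\<lambda>(a, b). joined n m a b) ` (configs U n \<times> configs U m) \<subseteq> configs U (n + m)"
    by (auto simp: joined_def configs_def PiE_iff extensional_def)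
  show "(\<lambda>w. (restrict w {..<n}, restrict (\<lambda>j. w (n + j)) {..<m})) ` configs U (n + m) \<subseteq> configs U n \<times> configs U m"
  proof (rule image_subsetI)
    fix w assume "w \<in> configs U (n + m)"
    then have "w j \<in> U" if "j < n + m" for j using that by (auto simp: configs_def)
    then show "(restrict w {..<n}, restrict (\<lambda>j. w (n + j)) {..<m}) \<in> configs U n \<times> configs U m"
      by (simp add: configs_def restrict_PiE_iff)
  qed
qed

lemma prob_config_joined: "prob_config p (n + m) (joined n m a b) = prob_config p n a * prob_config p m b"
proof -
  have split: "prod g {..<n + k} = prod g {..<n} * (\<Prod>j<k. g (n + j))" for g :: "nat \<Rightarrow> real" and k
    by (induction k) (auto simp: mult.assoc)
  show ?thesis unfolding prob_config_def split by (simp add: joined_def)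
qed

lemma sum_power_joined:
  fixes \<eta> :: complex
  shows "(\<Sum>j<n + m. joined n m a b j * \<eta> ^ j) = (\<Sum>j<n. a j * \<eta> ^ j) + \<eta> ^ n * (\<Sum>j<m. b j * \<eta> ^ j)"
proof -
  have split: "sum g {..<n + k} = sum g {..<n} + (\<Sum>j<k. g (n + j))" for g :: "nat \<Rightarrow> complex" and k
    by (induction k) (auto simp: add.assoc)
  show ?thesis unfolding split by (simp add: joined_def sum_distrib_left power_add mult_ac)
qed

text \<open>The sum over a concatenation is a function of the sums over its two parts. So the
  product of two fibres embeds into a fibre of the joint sum, and by independence the fibre masses
  satisfy \<open>F n * F m \<le> F (n + m)\<close>; taking \<open>- ln\<close> and averaging gives
  the claim.\<close>

lemma uncertainty_subadditive:
  fixes U :: "complex set" and p :: "complex \<Rightarrow> real" and \<eta> :: complex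
  assumes U: "finite U" "\<forall>u\<in>U. 0 \<le> p u" "sum p U = 1"
  defines "H \<equiv> \<lambda>n. uncertainty (configs U n) (\<lambda>w. \<Sum>j<n. w j * \<eta> ^ j) (prob_config p n)"
  shows "H (n + m) \<le> H n + H m"
proof -
  define Z where "Z n w = (\<Sum>j<n. w j * \<eta> ^ j)" for n w
  let ?P = "prob_config p" and ?W = "configs U"
  define F where "F n x = sum (?P n) {v \<in> ?W n. Z n v = x}" for n x
  have fin: "finite (?W n)" for n by (rule finite_configs[OF U])
  have P0: "0 \<le> ?P n w" if "w \<in> ?W n" for n w using weightD[OF weight_prob_config[OF U] that] .
  have P1: "sum (?P n) (?W n) = 1" for n by (rule sum_prob_config[OF U])
  have Fpos: "0 < F n (Z n w)" if "w \<in> ?W n" "0 < ?P n w" for n w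
    unfolding F_def using that fin P0 by (intro sum_pos2[of _ w]) auto
  have H: "H n = (\<Sum>w\<in>?W n. ?P n w * - ln (F n (Z n w)))" for n
    unfolding H_def uncertainty_def P1 F_def[symmetric] Z_def[symmetric]
  proof (rule sum.cong[OF refl])
    fix w assume "w \<in> ?W n"
    then show "?P n w * ln (1 / F n (Z n w)) = ?P n w * - ln (F n (Z n w))"
      using Fpos[of w n] P0[of w n] by (cases "?P n w = 0") (auto simp: ln_div)
  qed
  have F: "F n (Z n a) * F m (Z m b) \<le> F (n + m) (Z (n + m) (joined n m a b))"
    if "a \<in> ?W n" "b \<in> ?W m" for a b
  proof -
    let ?A = "{v \<in> ?W n. Z n v = Z n a}" and ?B = "{v \<in> ?W m. Z m v = Z m b}"
    have inj: "inj_on (\<lambda>(a, b). joined n m a b) (?A \<times> ?B)"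
      using bij_betw_imp_inj_on[OF bij_betw_joined[of n m U]] by (rule inj_on_subset) auto
    have "F n (Z n a) * F m (Z m b) = (\<Sum>(v, w)\<in>?A \<times> ?B. ?P n v * ?P m w)"
      unfolding F_def sum_product sum.cartesian_product ..
    also have "\<dots> = (\<Sum>x\<in>?A \<times> ?B. ?P (n + m) ((\<lambda>(a, b). joined n m a b) x))"
      by (intro sum.cong) (auto simp: prob_config_joined)
    also have "\<dots> = sum (?P (n + m)) ((\<lambda>(a, b). joined n m a b) ` (?A \<times> ?B))"
      using inj by (simp add: sum.reindex comp_def)
    also have "\<dots> \<le> F (n + m) (Z (n + m) (joined n m a b))"
      unfolding F_def
    proof (rule sum_mono2)
      show "(\<lambda>(a, b). joined n m a b) ` (?A \<times> ?B) \<subseteq> {v \<in> ?W (n + m). Z (n + m) v = Z (n + m) (joined n m a b)}"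
        using bij_betw_imp_surj_on[OF bij_betw_joined[of n m U]]
        by (auto simp: Z_def sum_power_joined)
    qed (use fin P0 in auto)
    finally show ?thesis .
  qed
  have "H (n + m) = (\<Sum>x\<in>?W n \<times> ?W m. ?P (n + m) ((\<lambda>(a, b). joined n m a b) x) *
      - ln (F (n + m) (Z (n + m) ((\<lambda>(a, b). joined n m a b) x))))"
    unfolding H by (rule sum.reindex_bij_betw[OF bij_betw_joined, symmetric])
  also have "\<dots> = (\<Sum>(a, b)\<in>?W n \<times> ?W m. ?P n a * ?P m b * - ln (F (n + m) (Z (n + m) (joined n m a b))))"
    by (intro sum.cong) (auto simp: prob_config_joined)
  also have "\<dots> \<le> (\<Sum>(a, b)\<in>?W n \<times> ?W m. ?P n a * ?P m b * (- ln (F n (Z n a)) + - ln (F m (Z m b))))"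
  proof (intro sum_mono, clarify)
    fix a b assume ab: "a \<in> ?W n" "b \<in> ?W m"
    show "?P n a * ?P m b * - ln (F (n + m) (Z (n + m) (joined n m a b))) \<le>
      ?P n a * ?P m b * (- ln (F n (Z n a)) + - ln (F m (Z m b)))"
    proof (cases "?P n a = 0 \<or> ?P m b = 0")
      case False
      then have "0 < F n (Z n a)" "0 < F m (Z m b)" using ab P0 Fpos by (auto simp: less_le)
      then have "ln (F n (Z n a)) + ln (F m (Z m b)) \<le> ln (F (n + m) (Z (n + m) (joined n m a b)))"
        using F[OF ab] less_le_trans[OF mult_pos_pos F[OF ab]]
        by (simp add: ln_mult_pos[symmetric] ln_le_cancel_iff)
      then show ?thesis using P0[OF ab(1)] P0[OF ab(2)] by (intro mult_left_mono) auto
    qed auto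
  qed
  also have "\<dots> = (\<Sum>a\<in>?W n. \<Sum>b\<in>?W m. ?P m b * (?P n a * - ln (F n (Z n a))) + ?P n a * (?P m b * - ln (F m (Z m b))))"
    unfolding sum.cartesian_product[symmetric] by (intro sum.cong refl) (simp add: algebra_simps)
  also have "\<dots> = H n + H m"
    unfolding sum.distrib sum_distrib_right[symmetric] sum_distrib_left[symmetric] P1 H by simp
  finally show ?thesis .
qed

subsection \<open>The lower bound for the Garsia entropy\<close>

lemma finite_law_atomic_law:
  assumes p: "\<And>j. j \<in> {1..m} \<Longrightarrow> p j \<ge> 0" "(\<Sum>j=1..m. p j) = 1"
  shows "finite_law (atomic_law m p u) (u ` {1..m})"
proof -
  have *: "emeasure (atomic_law m p u) A = 1" if A: "A \<in> sets borel" "u ` {1..m} \<subseteq> A" for A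
  proof -
    have "emeasure (atomic_law m p u) A = (\<Sum>j=1..m. ennreal (p j) * emeasure (return borel (u j)) A)"
      by (rule emeasure_atomic_law[OF A(1)])
    also have "\<dots> = (\<Sum>j=1..m. ennreal (p j))"
      using A by (intro sum.cong refl) (auto simp: indicator_def image_subset_iff)
    also have "\<dots> = 1" using p by (subst sum_ennreal) auto
    finally show ?thesis .
  qed
  interpret prob_space "atomic_law m p u"
    by (rule prob_spaceI) (use * in simp)
  have "emeasure (atomic_law m p u) (u ` {1..m}) = 1"
    by (rule *) (auto intro: borel_closed finite_imp_closed)
  then show ?thesis by unfold_locales (auto simp: measure_def)
qed

text \<open>For every \<open>n\<close> the entropy \<open>H n\<close> is at least
  \<open>n * D\<close>. Convergence of \<open>H n / n\<close> is proved so that \<open>lim\<close>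
  denotes a genuine limit and inherits the bound.\<close>

lemma (in finite_law) garsia_entropy_ge:
  fixes \<eta> :: complex and I :: "complex set" and t :: real
  assumes I: "finite I" "\<forall>z\<in>I. z \<noteq> 0 \<and> cmod z < 1" "I \<noteq> {}" and t: "0 < t"
    and conj: "\<And>n v w z. v \<in> configs U n \<Longrightarrow> w \<in> configs U n \<Longrightarrow>
      (\<Sum>j<n. v j * \<eta> ^ j) = (\<Sum>j<n. w j * \<eta> ^ j) \<Longrightarrow> z \<in> I \<Longrightarrow>
      (\<Sum>j<n. v j * z ^ j) = (\<Sum>j<n. w j * z ^ j)"
  defines "a \<equiv> \<Prod>z\<in>I. 1 / cmod z"
  shows "smoothed_entropy \<nu> (t * a) - smoothed_entropy \<nu> t \<le> garsia_entropy \<eta> \<nu>"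
proof -
  define H where "H n = uncertainty (configs U n) (\<lambda>w. \<Sum>j<n. w j * \<eta> ^ j) (prob_config atom n)" for n
  define D where "D = smoothed_entropy \<nu> (t * a) - smoothed_entropy \<nu> t"
  obtain y where y: "(cmod (\<Sum>z\<in>I. y z))\<^sup>2 = t\<^sup>2 * (a\<^sup>2 - 1)"
      "\<And>N. (\<Sum>k<N. (cmod (\<Sum>z\<in>I. y z * z ^ Suc k))\<^sup>2) \<le> t\<^sup>2"
    using extremal_recurrence[OF I t] unfolding a_def by blast
  \<comment> \<open>Integer powers, since \<open>j - i - 1\<close> can be negative; the shift by 1
    places the distinguished leading coefficient at index \<open>- 1\<close>.\<close>
  define \<beta> where "\<beta> k = (\<Sum>z\<in>I. y z * z powi (k + 1))" for k
  have \<beta>: "\<beta> (- 1) = (\<Sum>z\<in>I. y z)" "\<beta> (int k) = (\<Sum>z\<in>I. y z * z ^ Suc k)" for k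
    by (simp_all add: \<beta>_def power_int_def nat_add_distrib)
  have a: "0 \<le> a" unfolding a_def by (intro prod_nonneg) auto
  \<comment> \<open>Each observation is a combination, with coefficients free of \<open>v\<close>,
    of the sums at the points of \<open>I\<close>; by \<open>conj\<close> it is therefore a function
    of the sum at \<open>\<eta>\<close>.\<close>
  have obs: "(\<Sum>j<n. v j * \<beta> (int j - int i - 1)) = (\<Sum>z\<in>I. y z * z powi (- int i) * (\<Sum>j<n. v j * z ^ j))" for n v i
  proof -
    have "(\<Sum>j<n. v j * \<beta> (int j - int i - 1)) = (\<Sum>j<n. \<Sum>z\<in>I. v j * (y z * z powi (int j - int i)))"
      by (simp add: \<beta>_def sum_distrib_left)
    also have "\<dots> = (\<Sum>z\<in>I. \<Sum>j<n. v j * (y z * z powi (int j - int i)))" by (rule sum.swap)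
    also have "\<dots> = (\<Sum>z\<in>I. y z * z powi (- int i) * (\<Sum>j<n. v j * z ^ j))"
      unfolding sum_distrib_left using I(2)
      by (intro sum.cong refl) (simp add: power_int_diff power_int_minus field_simps)
    finally show ?thesis .
  qed
  have bound: "n * D \<le> H n" for n
  proof -
    have "n * (enn2real (gain U (\<lambda>u. u * of_real (t * a)) atom) - enn2real (gain U (\<lambda>u. u * of_real t) atom)) \<le> H n"
      unfolding H_def
    proof (rule gain_le_uncertainty[OF finite_U atom_nonneg sum_atom])
      show "(t * a)\<^sup>2 = t\<^sup>2 + (cmod (\<beta> (- 1)))\<^sup>2"
        unfolding \<beta> y(1) by (simp add: power_mult_distrib algebra_simps)
      fix v w i assume "v \<in> configs U n" "w \<in> configs U n" "(\<Sum>j<n. v j * \<eta> ^ j) = (\<Sum>j<n. w j * \<eta> ^ j)"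
      then show "(\<Sum>j<n. v j * \<beta> (int j - int i - 1)) = (\<Sum>j<n. w j * \<beta> (int j - int i - 1))"
        unfolding obs by (intro sum.cong refl) (simp add: conj[of v n w])
    qed (use t a y \<beta> in auto)
    then show ?thesis by (simp add: D_def smoothed_entropy_eq)
  qed
  have "convergent (\<lambda>n. H n / n)"
  proof (rule subadditive_convergent)
    show "0 \<le> H n" for n unfolding H_def
      by (rule uncertainty_nonneg[OF finite_configs[OF finite_U atom_nonneg sum_atom]
            weight_prob_config[OF finite_U atom_nonneg sum_atom]])
    show "H (m + n) \<le> H m + H n" for m n
      unfolding H_def by (rule uncertainty_subadditive[OF finite_U atom_nonneg sum_atom])
  qed
  then have "(\<lambda>n. H n / n) \<longlonglongrightarrow> garsia_entropy \<eta> \<nu>"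
    unfolding garsia_entropy_def shannon_entropy_partial_sum H_def[symmetric]
    by (simp add: convergent_LIMSEQ_iff)
  moreover have "D \<le> H n / n" if "1 \<le> n" for n
    using bound[of n] that by (simp add: field_simps)
  ultimately show ?thesis unfolding D_def[symmetric] by (intro LIMSEQ_le_const) auto
qed

theorem proposition6p2:
  fixes K :: "complex set" and \<eta> :: complex
    and m :: nat and u :: "nat \<Rightarrow> complex" and p :: "nat \<Rightarrow> real"
  assumes "subfield K complex_ring"
    and "0 < cmod \<eta>" and "cmod \<eta> < 1"
    and "ring.finite_dimension complex_ring K (adjoin K \<eta>)"
    and "\<And>j. j \<in> {1..m} \<Longrightarrow> u j \<in> K"
    and "\<And>j. j \<in> {1..m} \<Longrightarrow> p j \<ge> 0" and "(\<Sum>j=1..m. p j) = 1"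
  shows "ereal (garsia_entropy \<eta> (atomic_law m p u)) \<ge> Phi (atomic_law m p u) (M_tilde K \<eta>)"
proof -
  note K = assms(1) assms(4)
  interpret finite_law "atomic_law m p u" "u ` {1..m}"
    by (rule finite_law_atomic_law) (use assms in auto)
  \<comment> \<open>Conjugates outside the open unit disc contribute the factor 1 to
    \<open>M_tilde\<close>; \<open>I\<close> is nonempty since it contains
    \<open>\<eta>\<close>.\<close>
  define I where "I = {z \<in> conjugates K \<eta>. cmod z < 1}"
  have fin: "finite (conjugates K \<eta>)" by (rule finite_conjugates[OF K])
  have I: "finite I" "\<forall>z\<in>I. z \<noteq> 0 \<and> cmod z < 1" "I \<noteq> {}"
    using fin zero_notin_conjugates[OF K] mem_conjugates[OF K] assms by (auto simp: I_def)
  have M: "M_tilde K \<eta> = (\<Prod>z\<in>I. 1 / cmod z)"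
  proof -
    have "M_tilde K \<eta> = (\<Prod>z\<in>I. 1 / min 1 (cmod z))"
      unfolding M_tilde_def by (rule prod.mono_neutral_right[OF fin]) (auto simp: I_def min_def)
    also have "\<dots> = (\<Prod>z\<in>I. 1 / cmod z)" by (intro prod.cong) (auto simp: I_def)
    finally show ?thesis .
  qed
  have uK: "u ` {1..m} \<subseteq> K" using assms(5) by (rule image_subsetI)
  have conj: "(\<Sum>j<n. v j * z ^ j) = (\<Sum>j<n. w j * z ^ j)"
    if v: "v \<in> configs (u ` {1..m}) n" and w: "w \<in> configs (u ` {1..m}) n"
      and eq: "(\<Sum>j<n. v j * \<eta> ^ j) = (\<Sum>j<n. w j * \<eta> ^ j)" and z: "z \<in> I" for n v w z
  proof -
    have "v j - w j \<in> K" if "j < n" for j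
    proof -
      have "v j \<in> u ` {1..m}" "w j \<in> u ` {1..m}" using v w that by (auto simp: configs_def)
      then have vw: "v j \<in> K" "w j \<in> K" using uK by (auto dest: subsetD)
      have "v j \<oplus>\<^bsub>complex_ring\<^esub> (\<ominus>\<^bsub>complex_ring\<^esub> w j) \<in> K"
        by (intro subringE(7)[OF subfieldE(1)[OF K(1)]] subringE(5)[OF subfieldE(1)[OF K(1)]] vw)
      moreover have "\<ominus>\<^bsub>complex_ring\<^esub> w j = - w j"
        by (rule cx.minus_equality) auto
      ultimately show ?thesis by simp
    qed
    then have mem: "\<And>j. j < n \<Longrightarrow> v j - w j \<in> K" .
    have 0: "(\<Sum>j<n. (v j - w j) * \<eta> ^ j) = 0"
      unfolding left_diff_distrib sum_subtractf eq by simp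
    have "z \<in> conjugates K \<eta>" using z by (simp add: I_def)
    then have "(\<Sum>j<n. (v j - w j) * z ^ j) = 0"
      by (rule conjugates_root[OF K _ mem 0])
    then show ?thesis by (simp add: left_diff_distrib sum_subtractf)
  qed
  show ?thesis
    unfolding Phi_def M
  proof (rule SUP_least)
    fix t :: real assume "t \<in> {0<..}"
    then have "0 < t" by simp
    then show "ereal (smoothed_entropy (atomic_law m p u) (t * (\<Prod>z\<in>I. 1 / cmod z)) -
        smoothed_entropy (atomic_law m p u) t) \<le> ereal (garsia_entropy \<eta> (atomic_law m p u))"
      unfolding ereal_less_eq by (rule garsia_entropy_ge[OF I _ conj])
  qed
qed

end
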